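(* Let $d\ge 2$ and let $k\ge 1$ be an integer. There is a constant $D(k,d)$, depending only on $k$ and $d$, such that for every $u\in C^{k+2}(\overline{B})$ with $u=0$ on $\partial B$ and every integer $n\ge 1$ there is a polynomial $q_n\in\mathcal{X}_n$ for which $$\|u-q_n\|_\infty\le D(k,d)\,n^{-k}\left(n^{-1}\|u\|_{\infty,k+2}+\omega\left(u^{(k+2)},1/n\right)\right).$$
   Context: $B$ is the open unit ball in $\mathbb{R}^d$. $\Pi_n$ is the space of real polynomials in $d$ variables of total degree $\le n$, and $\mathcal{X}_n=\{(1-\|\mathbf{x}\|_2^2)\,p(\mathbf{x}) : p\in\Pi_n\}$, where $\|\mathbf{x}\|_2^2=x_1^2+\cdots+x_d^2$. $\|\cdot\|_\infty$ is the supremum norm over $\overline{B}$. For multi-indices $i=(i_1,\dots,i_d)$ with $|i|=i_1+\cdots+i_d$, put $\|u\|_{\infty,k+2}=\sum_{|i|\le k+2}\|\partial^i u\|_\infty$. For a function $g$ on $\overline{B}$ let $\omega(g,\delta)=\sup\{|g(\mathbf{x})-g(\mathbf{y})| : \mathbf{x},\mathbf{y}\in\overline{B},\ |\mathbf{x}-\mathbf{y}|\le\delta\}$, and let $\omega(u^{(k+2)},\delta)=\sum_{|i|=k+2}\omega(\partial^i u,\delta)$. *)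

theory Defs
  imports "HOL-Analysis.Analysis"
begin

text \<open>Multi-indices are functions \<open>'n \<Rightarrow> nat\<close>; the unit ball is \<open>ball 0 1\<close>, its closure
  \<open>cball 0 1\<close> and its boundary \<open>sphere 0 1\<close>.\<close>

definition mi_order :: "('n::finite \<Rightarrow> nat) \<Rightarrow> nat" where
  "mi_order \<alpha> = (\<Sum>j\<in>UNIV. \<alpha> j)"

lemma finite_mi_order_le: "finite {\<alpha> :: 'n::finite \<Rightarrow> nat. mi_order \<alpha> \<le> m}"
proof (rule finite_subset)
  show "{\<alpha> :: 'n \<Rightarrow> nat. mi_order \<alpha> \<le> m} \<subseteq> UNIV \<rightarrow>\<^sub>E {..m}"
  proof (rule subsetI)
    fix \<alpha> :: "'n \<Rightarrow> nat"
    assume "\<alpha> \<in> {\<alpha>. mi_order \<alpha> \<le> m}"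
    moreover have "\<alpha> j \<le> mi_order \<alpha>" for j
      unfolding mi_order_def by (rule member_le_sum) auto
    ultimately show "\<alpha> \<in> UNIV \<rightarrow>\<^sub>E {..m}"
      by (auto intro: order_trans)
  qed
qed (simp add: finite_PiE)

subsection \<open>Polynomials\<close>

definition poly_space :: "nat \<Rightarrow> (real^'n \<Rightarrow> real) set" where
  "poly_space n = {p. \<exists>c :: ('n \<Rightarrow> nat) \<Rightarrow> real.
     p = (\<lambda>x. \<Sum>\<alpha> | mi_order \<alpha> \<le> n. c \<alpha> * (\<Prod>j\<in>UNIV. (x $ j) ^ \<alpha> j))}"

definition vanishing_poly_space :: "nat \<Rightarrow> (real^'n \<Rightarrow> real) set" where
  "vanishing_poly_space n = {\<lambda>x. (1 - (norm x)\<^sup>2) * p x | p. p \<in> poly_space n}"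

subsection \<open>Partial derivatives\<close>

definition has_partial_at :: "'n \<Rightarrow> (real^'n \<Rightarrow> real) \<Rightarrow> real^'n \<Rightarrow> bool" where
  "has_partial_at j f x \<longleftrightarrow> (\<lambda>t::real. f (x + t *\<^sub>R axis j 1)) field_differentiable at 0"

definition partial :: "'n \<Rightarrow> (real^'n \<Rightarrow> real) \<Rightarrow> real^'n \<Rightarrow> real" where
  "partial j f x = deriv (\<lambda>t::real. f (x + t *\<^sub>R axis j 1)) 0"

text \<open>The mixed partials of all orders up to \<open>m\<close>, taken in any order of differentiation,
  exist and are continuous.\<close>

primrec Ck_on :: "nat \<Rightarrow> (real^'n) set \<Rightarrow> (real^'n \<Rightarrow> real) \<Rightarrow> bool" where
  "Ck_on 0 S f \<longleftrightarrow> continuous_on S f"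
| "Ck_on (Suc m) S f \<longleftrightarrow> continuous_on S f \<and>
     (\<forall>j. (\<forall>x\<in>S. has_partial_at j f x) \<and> Ck_on m S (partial j f))"

text \<open>An arbitrary index type carries no order, so the order of differentiation in
  \<open>\<partial>\<^sup>\<alpha>\<close> is given by an arbitrary but fixed enumeration of the coordinates. By the symmetry of
  mixed partials, the choice does not matter for functions of class \<open>C\<^sup>m\<close> on an open set
  and \<open>mi_order \<alpha> \<le> m\<close>.\<close>

definition coords :: "'n::finite list" where
  "coords = (SOME js. distinct js \<and> set js = UNIV)"

definition mi_deriv :: "('n \<Rightarrow> nat) \<Rightarrow> (real^'n \<Rightarrow> real) \<Rightarrow> real^'n \<Rightarrow> real" where
  "mi_deriv \<alpha> f = foldr (\<lambda>j. partial j ^^ \<alpha> j) coords f"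

text \<open>\<open>C\<^sup>m\<close> on the closed ball: \<open>C\<^sup>m\<close> on the open ball, with all partial derivatives of order at
  most \<open>m\<close> extending continuously to the closed ball. Values of \<open>u\<close> outside the closed ball are
  irrelevant.\<close>

definition Ck_cball :: "nat \<Rightarrow> (real^'n \<Rightarrow> real) \<Rightarrow> bool" where
  "Ck_cball m u \<longleftrightarrow> continuous_on (cball 0 1) u \<and> Ck_on m (ball 0 1) u \<and>
     (\<forall>\<alpha>. mi_order \<alpha> \<le> m \<longrightarrow>
        (\<exists>g. continuous_on (cball 0 1) g \<and> (\<forall>x\<in>ball 0 1. g x = mi_deriv \<alpha> u x)))"

definition mi_deriv_cball :: "('n \<Rightarrow> nat) \<Rightarrow> (real^'n \<Rightarrow> real) \<Rightarrow> real^'n \<Rightarrow> real" where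
  "mi_deriv_cball \<alpha> u x =
     (if x \<in> ball 0 1 then mi_deriv \<alpha> u x else Lim (at x within ball 0 1) (mi_deriv \<alpha> u))"

subsection \<open>Norms and moduli of continuity\<close>

text \<open>These suprema of reals are meaningful for functions bounded on the closed ball, in
  particular for continuous ones.\<close>

definition sup_norm :: "(real^'n \<Rightarrow> real) \<Rightarrow> real" where
  "sup_norm f = (SUP x\<in>cball 0 1. \<bar>f x\<bar>)"

definition Ck_norm :: "nat \<Rightarrow> (real^'n \<Rightarrow> real) \<Rightarrow> real" where
  "Ck_norm m u = (\<Sum>\<alpha> | mi_order \<alpha> \<le> m. sup_norm (mi_deriv_cball \<alpha> u))"

definition modulus :: "(real^'n \<Rightarrow> real) \<Rightarrow> real \<Rightarrow> real" where
  "modulus g \<delta> = Sup {\<bar>g x - g y\<bar> | x y. x \<in> cball 0 1 \<and> y \<in> cball 0 1 \<and> dist x y \<le> \<delta>}"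

definition Ck_modulus :: "nat \<Rightarrow> (real^'n \<Rightarrow> real) \<Rightarrow> real \<Rightarrow> real" where
  "Ck_modulus m u \<delta> = (\<Sum>\<alpha> | mi_order \<alpha> = m. modulus (mi_deriv_cball \<alpha> u) \<delta>)"

end

theory Submission
  imports Defs
begin

text \<open>Since \<open>k + 2\<close> derivatives are available, it suffices to reach the error
  \<open>n\<^bsup>-(k+1)\<^esup> \<parallel>u\<parallel>\<^bsub>\<infinity>,k+2\<^esub>\<close>; one order may be wasted.
  A polynomial \<open>P\<close> with this error is obtained by smoothing \<open>u\<close> (extended by zero) with a power of the
  Dirichlet kernel, written as an algebraic polynomial in \<open>norm t\<close>; the truncation at the
  boundary is harmless because the points of evaluation are first moved inwards by more than the width
  of the kernel, and an \<open>m\<close>-th difference along the resulting segments restores the order of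
  approximation. As \<open>u\<close> vanishes on the sphere, \<open>P\<close> is small there. Multiplying each monomial
  of \<open>P\<close> by a power of \<open>(norm x)\<^sup>2\<close> makes the even and the odd part of \<open>P\<close> homogeneous without
  changing them on the sphere; by homogeneity the result is small on the ball, and subtracting
  it from \<open>P\<close> leaves a multiple of \<open>1 - (norm x)\<^sup>2\<close>.\<close>

subsection \<open>Partial derivatives\<close>

text \<open>Phrasing the mean value theorem on \<open>closed_segment\<close> covers increments of
  either sign, such as the components \<open>h $ j\<close> of a displacement.\<close>

lemma mvt_closed_segment:
  fixes \<phi> \<phi>' :: "real \<Rightarrow> real"
  assumes "\<And>s. s \<in> closed_segment a b \<Longrightarrow> (\<phi> has_real_derivative \<phi>' s) (at s)"
  shows "\<exists>s\<in>closed_segment a b. \<phi> b - \<phi> a = (b - a) * \<phi>' s"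
proof (cases a b rule: linorder_cases)
  case less
  then obtain z where "a < z" "z < b" "\<phi> b - \<phi> a = (b - a) * \<phi>' z"
    using MVT2[of a b \<phi> \<phi>'] assms by (auto simp: closed_segment_eq_real_ivl)
  then show ?thesis
    using less by (auto simp: closed_segment_eq_real_ivl intro!: bexI[of _ z])
next
  case greater
  then obtain z where "b < z" "z < a" "\<phi> a - \<phi> b = (a - b) * \<phi>' z"
    using MVT2[of b a \<phi> \<phi>'] assms by (auto simp: closed_segment_eq_real_ivl)
  then show ?thesis
    using greater by (auto simp: closed_segment_eq_real_ivl algebra_simps intro!: bexI[of _ z])
qed auto

lemma has_partial_at_DERIV:
  assumes "has_partial_at j f (x + s *\<^sub>R axis j 1)"
  shows "((\<lambda>t. f (x + t *\<^sub>R axis j 1)) has_real_derivative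
           partial j f (x + s *\<^sub>R axis j 1)) (at s)"
proof -
  have "((\<lambda>t. f ((x + s *\<^sub>R axis j 1) + t *\<^sub>R axis j 1)) has_real_derivative
          partial j f (x + s *\<^sub>R axis j 1)) (at 0)"
    using assms by (simp add: has_partial_at_def partial_def field_differentiable_derivI)
  moreover have "(\<lambda>t. f ((x + s *\<^sub>R axis j 1) + t *\<^sub>R axis j 1)) = (\<lambda>t. f (x + (t + s) *\<^sub>R axis j 1))"
    by (simp add: algebra_simps)
  ultimately show ?thesis
    using DERIV_shift[of "\<lambda>t. f (x + t *\<^sub>R axis j 1)" _ 0 s] by simp
qed

lemma partial_mvt:
  assumes "\<And>s. s \<in> closed_segment 0 h \<Longrightarrow> has_partial_at j f (x + s *\<^sub>R axis j 1)"
  shows "\<exists>s\<in>closed_segment 0 h. f (x + h *\<^sub>R axis j 1) - f x = h * partial j f (x + s *\<^sub>R axis j 1)"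
  using mvt_closed_segment[of 0 h, OF has_partial_at_DERIV[OF assms]] by simp

lemma eventually_axis_line:
  fixes x :: "real^'n"
  assumes "open S" "x \<in> S"
  shows "\<forall>\<^sub>F t in nhds 0. x + t *\<^sub>R axis j (1::real) \<in> S"
proof -
  have "isCont (\<lambda>t. x + t *\<^sub>R axis j (1::real)) 0"
    by (intro continuous_intros)
  then have "filterlim (\<lambda>t. x + t *\<^sub>R axis j (1::real)) (nhds x) (nhds 0)"
    by (simp add: continuous_at_imp_continuous_within isCont_def tendsto_nhds_iff)
  then show ?thesis
    using assms by (auto simp: filterlim_iff eventually_nhds)
qed

lemma partial_cong:
  fixes x :: "real^'n"
  assumes "open S" "x \<in> S" "\<And>y. y \<in> S \<Longrightarrow> f y = g y"
  shows "partial j f x = partial j g x"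
proof -
  have "\<forall>\<^sub>F t in nhds 0. f (x + t *\<^sub>R axis j (1::real)) = g (x + t *\<^sub>R axis j 1)"
    using eventually_axis_line[OF assms(1,2), of j] by eventually_elim (rule assms(3))
  then show ?thesis
    unfolding partial_def by (intro deriv_cong_ev) auto
qed

lemma Ck_on_SucD: "Ck_on (Suc m) S f \<Longrightarrow> Ck_on m S f"
  by (induction m arbitrary: f) auto

lemma Ck_on_mono: "Ck_on m S f \<Longrightarrow> l \<le> m \<Longrightarrow> Ck_on l S f"
  by (induction m) (auto simp: le_Suc_eq dest: Ck_on_SucD simp del: Ck_on.simps)

lemma Ck_on_foldr_partial:
  assumes "Ck_on m S f" "length js \<le> m"
  shows "Ck_on (m - length js) S (foldr partial js f)"
  using assms(2)
proof (induction js)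
  case (Cons j js)
  then have "Ck_on (Suc (m - length (j # js))) S (foldr partial js f)"
    by (simp add: Suc_diff_Suc del: Ck_on.simps)
  then show ?case by simp
qed (use assms(1) in simp)

subsection \<open>Symmetry of mixed partials\<close>

text \<open>The second difference is the increment of \<open>\<psi>\<close>; apply the mean value
  theorem along axis \<open>i\<close> and then along axis \<open>j\<close>. The left-hand side is
  symmetric in \<open>i\<close> and \<open>j\<close>, so exchanging them represents the same
  quantity by the other mixed partial.\<close>

lemma second_difference_mvt:
  fixes x :: "real^'n"
  assumes "Ck_on 2 S f" "cball x (2 * s) \<subseteq> S" "s > 0"
  shows "\<exists>p\<in>cball x (2 * s). f (x + s *\<^sub>R axis i 1 + s *\<^sub>R axis j 1) - f (x + s *\<^sub>R axis i 1)
           - f (x + s *\<^sub>R axis j 1) + f x = s * s * partial j (partial i f) p"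
proof -
  have mem: "x + a *\<^sub>R axis i 1 + b *\<^sub>R axis j 1 \<in> cball x (2 * s)"
    if "0 \<le> a" "a \<le> s" "0 \<le> b" "b \<le> s" for a b :: real
  proof -
    have "norm (a *\<^sub>R axis i 1 + b *\<^sub>R axis j 1 :: real^'n) \<le> a + b"
      using that by (intro norm_triangle_le) simp
    then have "dist (x + (a *\<^sub>R axis i 1 + b *\<^sub>R axis j 1)) x \<le> a + b"
      by (simp only: dist_norm add_diff_cancel_left')
    then show ?thesis using that by (simp add: dist_commute add.assoc)
  qed
  have C: "has_partial_at i f y" "has_partial_at j (partial i f) y" if "y \<in> cball x (2 * s)" for y
    using assms(1,2) that by (auto simp: numeral_2_eq_2)
  define \<psi> where "\<psi> t = f (x + s *\<^sub>R axis j 1 + t *\<^sub>R axis i 1) - f (x + t *\<^sub>R axis i 1)" for t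
  define \<psi>' where "\<psi>' t = partial i f (x + s *\<^sub>R axis j 1 + t *\<^sub>R axis i 1)
                           - partial i f (x + t *\<^sub>R axis i 1)" for t
  have "(\<psi> has_real_derivative \<psi>' t) (at t)" if "t \<in> closed_segment 0 s" for t
    unfolding \<psi>_def \<psi>'_def
    using that assms(3) mem[of t s] mem[of t 0]
    by (intro DERIV_diff has_partial_at_DERIV C) (auto simp: closed_segment_eq_real_ivl algebra_simps)
  from mvt_closed_segment[of 0 s, OF this] obtain t where t: "0 \<le> t" "t \<le> s" "\<psi> s - \<psi> 0 = s * \<psi>' t"
    using assms(3) by (auto simp: closed_segment_eq_real_ivl)
  have "\<exists>r\<in>closed_segment 0 s. partial i f (x + t *\<^sub>R axis i 1 + s *\<^sub>R axis j 1) - partial i f (x + t *\<^sub>R axis i 1)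
      = s * partial j (partial i f) (x + t *\<^sub>R axis i 1 + r *\<^sub>R axis j 1)"
    using t assms(3) by (intro partial_mvt C mem) (auto simp: closed_segment_eq_real_ivl)
  then obtain r where r: "0 \<le> r" "r \<le> s"
    "\<psi>' t = s * partial j (partial i f) (x + t *\<^sub>R axis i 1 + r *\<^sub>R axis j 1)"
    using assms(3) by (auto simp: closed_segment_eq_real_ivl \<psi>'_def algebra_simps)
  show ?thesis
    using t r by (intro bexI[OF _ mem[OF t(1,2) r(1,2)]]) (simp add: \<psi>_def algebra_simps)
qed

text \<open>Schwarz's theorem: one second difference equals \<open>s * s\<close> times either mixed
  partial at points within \<open>2 * s\<close> of \<open>x\<close>. If the mixed partials differed
  at \<open>x\<close>, continuity would keep these values apart for small \<open>s\<close>.\<close>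

lemma partial_commute:
  fixes x :: "real^'n"
  assumes "open S" "Ck_on 2 S f" "x \<in> S"
  shows "partial i (partial j f) x = partial j (partial i f) x"
proof (rule ccontr)
  assume ne: "\<not> ?thesis"
  define A B where "A = partial j (partial i f)" and "B = partial i (partial j f)"
  \<comment> \<open>Half the gap: two deviations below \<open>e\<close> cannot close it.\<close>
  define e where "e = \<bar>A x - B x\<bar> / 2"
  have e: "e > 0" using ne by (simp add: e_def A_def B_def)
  have cont: "continuous_on S A" "continuous_on S B"
    using assms(2) by (auto simp: A_def B_def numeral_2_eq_2)
  obtain a where a: "a > 0" "\<And>y. y \<in> S \<Longrightarrow> dist y x < a \<Longrightarrow> dist (A y) (A x) < e"
    using cont(1) assms(3) e unfolding continuous_on_iff by metis
  obtain b where b: "b > 0" "\<And>y. y \<in> S \<Longrightarrow> dist y x < b \<Longrightarrow> dist (B y) (B x) < e"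
    using cont(2) assms(3) e unfolding continuous_on_iff by metis
  obtain r where r: "r > 0" "cball x r \<subseteq> S"
    using assms(1,3) open_contains_cball by metis
  define s where "s = min r (min (a/2) (b/2)) / 2"
  have s: "s > 0" "2 * s \<le> r" "2 * s < a" "2 * s < b"
    using a(1) b(1) r(1) by (auto simp: s_def min_def)
  have sub: "cball x (2 * s) \<subseteq> S" using s r by (auto simp: subset_iff)
  obtain p where p: "p \<in> cball x (2 * s)" "f (x + s *\<^sub>R axis i 1 + s *\<^sub>R axis j 1) - f (x + s *\<^sub>R axis i 1)
           - f (x + s *\<^sub>R axis j 1) + f x = s * s * A p"
    using second_difference_mvt[OF assms(2) sub s(1), of i j] by (auto simp: A_def)
  obtain q where q: "q \<in> cball x (2 * s)" "f (x + s *\<^sub>R axis j 1 + s *\<^sub>R axis i 1) - f (x + s *\<^sub>R axis j 1)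
           - f (x + s *\<^sub>R axis i 1) + f x = s * s * B q"
    using second_difference_mvt[OF assms(2) sub s(1), of j i] by (auto simp: B_def)
  have "s * s * A p = s * s * B q"
    using p(2) q(2) by (simp add: algebra_simps)
  then have "A p = B q" using s(1) by simp
  moreover have "dist (A p) (A x) < e" "dist (B q) (B x) < e"
    using a(2)[of p] b(2)[of q] p(1) q(1) s sub by (auto simp: dist_commute subset_iff)
  ultimately have "\<bar>A x - B x\<bar> < e + e"
    unfolding dist_real_def by linarith
  then show False by (simp add: e_def)
qed

lemma foldr_partial_move_front:
  fixes f :: "real^'n \<Rightarrow> real"
  assumes "open S" "Ck_on m S f" "length (is @ j # js) \<le> m" "x \<in> S"
  shows "foldr partial (is @ j # js) f x = partial j (foldr partial (is @ js) f) x"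
  using assms(3,4)
proof (induction "is" arbitrary: x)
  case (Cons i "is")
  \<comment> \<open>The two partials to be exchanged act on a derivative of order at most
    \<open>m - 2\<close>, which is still of class C^2.\<close>
  have "Ck_on 2 S (foldr partial (is @ js) f)"
    using Cons.prems by (intro Ck_on_mono[OF Ck_on_foldr_partial[OF assms(2)]]) auto
  then have "partial i (partial j (foldr partial (is @ js) f)) x
      = partial j (partial i (foldr partial (is @ js) f)) x"
    by (intro partial_commute[OF assms(1)] Cons.prems)
  moreover have "partial i (foldr partial (is @ j # js) f) x
      = partial i (partial j (foldr partial (is @ js) f)) x"
    using Cons by (intro partial_cong[OF assms(1)]) auto
  ultimately show ?case by simp
qed simp

text \<open>Induction on \<open>js\<close>: its head occurs somewhere in \<open>ks\<close> and can
  be moved to the front there.\<close>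

lemma foldr_partial_mset_cong:
  fixes f :: "real^'n \<Rightarrow> real"
  assumes "open S" "Ck_on m S f" "length js \<le> m" "mset js = mset ks" "x \<in> S"
  shows "foldr partial js f x = foldr partial ks f x"
  using assms(3-5)
proof (induction js arbitrary: ks x)
  case (Cons j js)
  have "j \<in> set ks" using Cons.prems(2) by (metis list.set_intros(1) set_mset_mset)
  then obtain ks1 ks2 where ks: "ks = ks1 @ j # ks2" by (meson split_list)
  have len: "length ks \<le> m" using Cons.prems by (metis mset_eq_length)
  have "foldr partial (j # js) f x = partial j (foldr partial (ks1 @ ks2) f) x"
    unfolding foldr_Cons comp_def using Cons.prems ks
    by (intro partial_cong[OF assms(1)] Cons.IH) auto
  also have "\<dots> = foldr partial ks f x"
    using foldr_partial_move_front[OF assms(1,2) _ Cons.prems(3), of ks1 j ks2] len ks by simp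
  finally show ?case .
qed simp

section \<open>Words of partial derivatives and multi-indices\<close>

lemma distinct_coords: "distinct (coords :: 'n::finite list)"
  and set_coords: "set (coords :: 'n::finite list) = UNIV"
proof -
  have "\<exists>js :: 'n list. distinct js \<and> set js = UNIV"
    using finite_distinct_list[of "UNIV :: 'n set"] by auto
  from someI_ex[OF this] show "distinct (coords :: 'n list)" "set (coords :: 'n list) = UNIV"
    unfolding coords_def by auto
qed

lemma mi_deriv_eq_foldr_partial:
  "mi_deriv \<alpha> f = foldr partial (concat (map (\<lambda>j. replicate (\<alpha> j) j) coords)) f"
proof -
  have "foldr partial (replicate n j) g = (partial j ^^ n) g" for n j and g :: "real^'n \<Rightarrow> real"
    by (induction n) auto
  then have "foldr (\<lambda>j. partial j ^^ \<alpha> j) js f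
      = foldr partial (concat (map (\<lambda>j. replicate (\<alpha> j) j) js)) f" for js
    by (induction js) auto
  then show ?thesis by (simp add: mi_deriv_def)
qed

lemma mset_concat_replicate_coords:
  "mset (concat (map (\<lambda>j. replicate (\<alpha> j) j) coords)) = mset js" if "\<alpha> = count (mset js)"
proof (rule multiset_eqI)
  fix i
  have "count (mset (concat (map (\<lambda>j. replicate (\<alpha> j) j) ks))) i = (if i \<in> set ks then \<alpha> i else 0)"
    if "distinct ks" for ks
    using that by (induction ks) auto
  from this[of coords] show "count (mset (concat (map (\<lambda>j. replicate (\<alpha> j) j) coords))) i = count (mset js) i"
    by (simp add: distinct_coords set_coords that)
qed

lemma mi_order_count_mset: "mi_order (count (mset js)) = length js"
  unfolding mi_order_def
proof (induction js)
  case (Cons a js)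
  have "(\<Sum>j\<in>UNIV. count (mset (a # js)) j) = (\<Sum>j\<in>UNIV. count (mset js) j + (if j = a then 1 else 0))"
    by (intro sum.cong) auto
  then show ?case using Cons by (simp add: sum.distrib)
qed simp

text \<open>Repeated mean value arguments produce words of partials, whereas \<open>Ck_norm\<close>
  sums over multi-indices; this translates the former into the latter.\<close>

lemma foldr_partial_eq_mi_deriv:
  fixes f :: "real^'n \<Rightarrow> real"
  assumes "open S" "Ck_on m S f" "length js \<le> m" "x \<in> S"
  shows "foldr partial js f x = mi_deriv (count (mset js)) f x"
  unfolding mi_deriv_eq_foldr_partial
  by (rule foldr_partial_mset_cong[OF assms(1-3) mset_concat_replicate_coords[symmetric] assms(4)]) simp

subsection \<open>The norms of \<open>C\<^sup>m\<close> functions on the closed ball\<close>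

text \<open>Every boundary point is a limit point of the open ball, so the \<open>Lim\<close> in the
  definition is unique and agrees with any continuous extension.\<close>

lemma mi_deriv_cball_eq:
  fixes u :: "real^'n \<Rightarrow> real"
  assumes "continuous_on (cball 0 1) g" "\<And>x. x \<in> ball 0 1 \<Longrightarrow> g x = mi_deriv \<alpha> u x"
    and x: "x \<in> cball 0 1"
  shows "mi_deriv_cball \<alpha> u x = g x"
proof (cases "x \<in> ball 0 1")
  case False
  have "x islimpt ball 0 1"
    using x by (subst islimpt_ball) auto
  then have nt: "at x within ball 0 1 \<noteq> bot"
    by (simp add: trivial_limit_within)
  have "(g \<longlongrightarrow> g x) (at x within cball 0 1)"
    using assms(1) x by (auto simp: continuous_on)
  then have "(g \<longlongrightarrow> g x) (at x within ball 0 1)"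
    by (rule tendsto_within_subset) auto
  then have "(mi_deriv \<alpha> u \<longlongrightarrow> g x) (at x within ball 0 1)"
    by (rule Lim_transform_eventually) (use assms(2) in \<open>auto simp: eventually_at_filter\<close>)
  then show ?thesis
    using False tendsto_Lim[OF nt] by (simp add: mi_deriv_cball_def)
qed (use assms(2) in \<open>simp add: mi_deriv_cball_def\<close>)

lemma mi_deriv_cball_continuous:
  assumes "Ck_cball m u" "mi_order \<alpha> \<le> m"
  shows "continuous_on (cball 0 1) (mi_deriv_cball \<alpha> u)"
proof -
  obtain g where g: "continuous_on (cball 0 1) g" "\<And>x. x \<in> ball 0 1 \<Longrightarrow> g x = mi_deriv \<alpha> u x"
    using assms unfolding Ck_cball_def by metis
  show ?thesis
    by (rule continuous_on_eq[OF g(1)]) (use mi_deriv_cball_eq[OF g] in auto)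
qed

lemma bounded_image_cball:
  fixes g :: "real^'n \<Rightarrow> real"
  assumes "continuous_on (cball 0 1) g"
  shows "bounded (g ` cball 0 1)"
  using assms by (intro compact_imp_bounded compact_continuous_image) auto

lemma abs_le_sup_norm:
  fixes g :: "real^'n \<Rightarrow> real"
  assumes "continuous_on (cball 0 1) g" "x \<in> cball 0 1"
  shows "\<bar>g x\<bar> \<le> sup_norm g"
proof -
  obtain b where b: "\<And>y. y \<in> cball 0 1 \<Longrightarrow> \<bar>g y\<bar> \<le> b"
    using bounded_image_cball[OF assms(1)] unfolding bounded_iff ball_simps real_norm_def by blast
  show ?thesis
    unfolding sup_norm_def by (intro cSUP_upper assms(2) bdd_aboveI2[where M = b] b)
qed

lemma abs_mi_deriv_le_Ck_norm:
  fixes u :: "real^'n \<Rightarrow> real"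
  assumes "Ck_cball m u" "mi_order \<alpha> \<le> m" "x \<in> ball 0 1"
  shows "\<bar>mi_deriv \<alpha> u x\<bar> \<le> Ck_norm m u"
proof -
  have "0 \<le> sup_norm (mi_deriv_cball \<beta> u)" if "mi_order \<beta> \<le> m" for \<beta>
    using abs_le_sup_norm[OF mi_deriv_cball_continuous[OF assms(1) that], of 0] by simp
  then have "sup_norm (mi_deriv_cball \<alpha> u) \<le> Ck_norm m u"
    unfolding Ck_norm_def by (intro member_le_sum) (use assms(2) finite_mi_order_le in auto)
  moreover have "\<bar>mi_deriv_cball \<alpha> u x\<bar> \<le> sup_norm (mi_deriv_cball \<alpha> u)"
    using assms by (intro abs_le_sup_norm mi_deriv_cball_continuous) auto
  ultimately show ?thesis
    using assms(3) by (simp add: mi_deriv_cball_def)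
qed

lemma abs_foldr_partial_le_Ck_norm:
  fixes u :: "real^'n \<Rightarrow> real"
  assumes "Ck_cball m u" "length js \<le> m" "x \<in> ball 0 1"
  shows "\<bar>foldr partial js u x\<bar> \<le> Ck_norm m u"
  using abs_mi_deriv_le_Ck_norm[OF assms(1) _ assms(3)] assms
    foldr_partial_eq_mi_deriv[of "ball 0 1" m u js x]
  by (auto simp: Ck_cball_def mi_order_count_mset)

text \<open>\<open>Sup\<close> on the reals is informative only for bounded sets: continuity on the
  compact ball supplies the bound, and x = y puts 0 into the set.\<close>

lemma Ck_modulus_nonneg:
  fixes u :: "real^'n \<Rightarrow> real"
  assumes "Ck_cball m u" "\<delta> \<ge> 0"
  shows "Ck_modulus m u \<delta> \<ge> 0"
  unfolding Ck_modulus_def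
proof (rule sum_nonneg)
  fix \<alpha> :: "'n \<Rightarrow> nat"
  assume "\<alpha> \<in> {\<alpha>. mi_order \<alpha> = m}"
  then have c: "continuous_on (cball 0 1) (mi_deriv_cball \<alpha> u)"
    by (intro mi_deriv_cball_continuous[OF assms(1)]) auto
  let ?g = "mi_deriv_cball \<alpha> u"
  obtain b where b: "\<And>y. y \<in> cball 0 1 \<Longrightarrow> \<bar>?g y\<bar> \<le> b"
    using bounded_image_cball[OF c] unfolding bounded_iff ball_simps real_norm_def by blast
  have "\<bar>?g x - ?g y\<bar> \<le> b + b" if "x \<in> cball 0 1" "y \<in> cball 0 1" for x y
    using b[OF that(1)] b[OF that(2)] by linarith
  then have "bdd_above {\<bar>?g x - ?g y\<bar> | x y. x \<in> cball 0 1 \<and> y \<in> cball 0 1 \<and> dist x y \<le> \<delta>}"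
    unfolding bdd_above_def by blast
  then show "0 \<le> modulus ?g \<delta>"
    unfolding modulus_def using assms(2) by (intro cSup_upper) (auto intro!: exI[of _ 0])
qed

subsection \<open>Iterated differences\<close>

text \<open>Continuous partials give total differentiability: move from \<open>x\<close> to
  \<open>x + h\<close> one coordinate at a time and use the mean value theorem for each move.
  Inducting over a finite set of coordinates avoids choosing an order on them.\<close>

lemma has_derivative_partials:
  fixes x :: "real^'n"
  assumes "open S" "Ck_on 1 S f" "x \<in> S"
  shows "(f has_derivative (\<lambda>h. \<Sum>j\<in>UNIV. h $ j * partial j f x)) (at x)"
  unfolding has_derivative_at_alt
proof (intro conjI allI impI)
  show "bounded_linear (\<lambda>h. \<Sum>j\<in>UNIV. h $ j * partial j f x)"
    by (intro bounded_linear_sum bounded_linear_mult_const bounded_linear_vec_nth)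
  fix e :: real
  assume e: "e > 0"
  define d where "d = real CARD('n)"
  have d: "d > 0" by (simp add: d_def)
  have C: "\<And>j. continuous_on S (partial j f)" "\<And>j y. y \<in> S \<Longrightarrow> has_partial_at j f y"
    using assms(2) by auto
  obtain r where r: "r > 0" "ball x r \<subseteq> S"
    using assms(1,3) open_contains_ball by metis
  have "\<forall>j. \<exists>a>0. \<forall>y\<in>S. dist y x < a \<longrightarrow> dist (partial j f y) (partial j f x) < e / d"
    using C(1) assms(3) divide_pos_pos[OF e d] unfolding continuous_on_iff by blast
  then obtain a where a: "\<And>j. a j > 0"
    "\<And>j y. y \<in> S \<Longrightarrow> dist y x < a j \<Longrightarrow> dist (partial j f y) (partial j f x) < e / d"
    unfolding choice_iff by blast
  \<comment> \<open>The intermediate points are within the sum of the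
    \<open>\<bar>h $ j\<bar>\<close> of \<open>x\<close>, which is at most
    \<open>d * norm h\<close>; hence the division by \<open>d\<close>.\<close>
  define \<rho> where "\<rho> = min r (Min (range a)) / d"
  have \<rho>: "\<rho> > 0" "\<And>j. \<rho> * d \<le> a j" "\<rho> * d \<le> r"
    using r(1) a(1) d by (auto simp: \<rho>_def min_le_iff_disj)
  show "\<exists>\<rho>>0. \<forall>y. norm (y - x) < \<rho> \<longrightarrow>
      norm (f y - f x - (\<Sum>j\<in>UNIV. (y - x) $ j * partial j f x)) \<le> e * norm (y - x)"
  proof (intro exI[of _ \<rho>] conjI allI impI \<rho>(1))
    fix y assume y: "norm (y - x) < \<rho>"
    define h where "h = y - x"
    have sn: "(\<Sum>j\<in>UNIV. \<bar>h $ j\<bar>) \<le> d * norm h"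
      unfolding d_def by (rule sum_bounded_above[where K = "norm h", THEN order_trans])
        (auto simp: component_le_norm_cart)
    then have small: "(\<Sum>j\<in>UNIV. \<bar>h $ j\<bar>) < \<rho> * d"
      using y d h_def by (smt (verit) mult.commute mult_strict_left_mono)
    have "\<bar>f (x + (\<Sum>j\<in>J. (h $ j) *\<^sub>R axis j 1)) - f x - (\<Sum>j\<in>J. h $ j * partial j f x)\<bar>
        \<le> (\<Sum>j\<in>J. \<bar>h $ j\<bar>) * (e / d)" for J :: "'n set"
      using finite[of J]
    proof (induction J rule: finite_induct)
      case (insert i J)
      define z where "z = x + (\<Sum>j\<in>J. (h $ j) *\<^sub>R axis j (1::real))"
      have mem: "dist (z + s *\<^sub>R axis i 1) x < \<rho> * d" if "s \<in> closed_segment 0 (h $ i)" for s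
      proof -
        have "\<bar>s\<bar> \<le> \<bar>h $ i\<bar>"
          using that by (auto simp: closed_segment_eq_real_ivl split: if_splits)
        then have "norm ((\<Sum>j\<in>J. (h $ j) *\<^sub>R axis j 1) + s *\<^sub>R axis i 1 :: real^'n)
            \<le> (\<Sum>j\<in>J. \<bar>h $ j\<bar>) + \<bar>h $ i\<bar>"
          by (intro norm_triangle_mono sum_norm_le) auto
        also have "\<dots> = (\<Sum>j\<in>insert i J. \<bar>h $ j\<bar>)"
          using insert by simp
        also have "\<dots> \<le> (\<Sum>j\<in>UNIV. \<bar>h $ j\<bar>)"
          by (intro sum_mono2) auto
        finally show ?thesis using small by (simp add: z_def dist_norm algebra_simps)
      qed
      have memS: "z + s *\<^sub>R axis i 1 \<in> S" if "s \<in> closed_segment 0 (h $ i)" for s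
        using mem[OF that] \<rho>(3) r(2) by (auto simp: dist_commute subset_iff)
      obtain s where s: "s \<in> closed_segment 0 (h $ i)"
        "f (z + (h $ i) *\<^sub>R axis i 1) - f z = h $ i * partial i f (z + s *\<^sub>R axis i 1)"
        using partial_mvt[OF C(2)[OF memS]] by blast
      have "dist (partial i f (z + s *\<^sub>R axis i 1)) (partial i f x) < e / d"
        using mem[OF s(1)] \<rho>(2)[of i] by (intro a(2) memS s(1)) auto
      then have "\<bar>h $ i * (partial i f (z + s *\<^sub>R axis i 1) - partial i f x)\<bar> \<le> \<bar>h $ i\<bar> * (e / d)"
        unfolding abs_mult by (intro mult_left_mono) (auto simp: dist_real_def)
      moreover have "\<bar>f z - f x - (\<Sum>j\<in>J. h $ j * partial j f x)\<bar> \<le> (\<Sum>j\<in>J. \<bar>h $ j\<bar>) * (e / d)"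
        using insert.IH by (simp add: z_def)
      moreover have "f (x + (\<Sum>j\<in>insert i J. (h $ j) *\<^sub>R axis j 1)) - f x
          - (\<Sum>j\<in>insert i J. h $ j * partial j f x)
          = (f z - f x - (\<Sum>j\<in>J. h $ j * partial j f x))
            + h $ i * (partial i f (z + s *\<^sub>R axis i 1) - partial i f x)"
        using s(2) insert.hyps by (simp add: z_def algebra_simps)
      moreover have "(\<Sum>j\<in>insert i J. \<bar>h $ j\<bar>) * (e / d)
          = (\<Sum>j\<in>J. \<bar>h $ j\<bar>) * (e / d) + \<bar>h $ i\<bar> * (e / d)"
        using insert.hyps by (simp add: algebra_simps)
      ultimately show ?case by linarith
    qed simp
    from this[of UNIV] have "\<bar>f y - f x - (\<Sum>j\<in>UNIV. h $ j * partial j f x)\<bar> \<le> (\<Sum>j\<in>UNIV. \<bar>h $ j\<bar>) * (e / d)"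
      using basis_expansion[of h] by (simp add: h_def scalar_mult_eq_scaleR)
    also have "\<dots> \<le> (d * norm h) * (e / d)"
      using sn e d by (intro mult_right_mono) auto
    finally show "norm (f y - f x - (\<Sum>j\<in>UNIV. (y - x) $ j * partial j f x)) \<le> e * norm (y - x)"
      using d by (simp add: h_def mult.commute)
  qed
qed

primrec fdiff :: "nat \<Rightarrow> 'a::real_vector \<Rightarrow> ('a \<Rightarrow> real) \<Rightarrow> 'a \<Rightarrow> real" where
  "fdiff 0 v f x = f x"
| "fdiff (Suc m) v f x = fdiff m v f (x + v) - fdiff m v f x"

text \<open>The \<open>b i\<close> are signed binomial coefficients, kept abstract. Later use rests
  on their depending on \<open>m\<close> alone and on \<open>f x\<close> having coefficient 1 or -1,
  so that \<open>f x\<close> can be solved for.\<close>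

lemma fdiff_expand:
  "\<exists>b. b 0 = (-1) ^ m \<and> (\<forall>(v::'a::real_vector) f x. fdiff m v f x = (\<Sum>i\<le>m. b i * f (x + real i *\<^sub>R v)))"
proof (induction m)
  case 0
  show ?case by (rule exI[of _ "\<lambda>_. 1"]) simp
next
  case (Suc m)
  then obtain b where b: "b 0 = (-1) ^ m"
    "\<And>(v::'a) f x. fdiff m v f x = (\<Sum>i\<le>m. b i * f (x + real i *\<^sub>R v))" by blast
  \<comment> \<open>\<open>b1\<close> and \<open>b2\<close> are \<open>b\<close> padded with zeros
    to the indices up to \<open>m + 1\<close>, in place and shifted by one; their difference is
    Pascal's rule.\<close>
  define b1 where "b1 i = (if i \<le> m then b i else 0)" for i
  define b2 where "b2 i = (case i of 0 \<Rightarrow> 0 | Suc i \<Rightarrow> b i)" for i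
  have "fdiff (Suc m) v f x = (\<Sum>i\<le>Suc m. (b2 i - b1 i) * f (x + real i *\<^sub>R v))" for v :: 'a and f x
  proof -
    have "(\<Sum>i\<le>Suc m. b2 i * f (x + real i *\<^sub>R v)) = (\<Sum>i\<le>m. b i * f (x + v + real i *\<^sub>R v))"
      by (subst sum.atMost_Suc_shift) (simp add: b2_def algebra_simps)
    moreover have "(\<Sum>i\<le>Suc m. b1 i * f (x + real i *\<^sub>R v)) = (\<Sum>i\<le>m. b i * f (x + real i *\<^sub>R v))"
      by (simp add: b1_def)
    ultimately show ?thesis
      by (simp add: b(2) left_diff_distrib sum_subtractf)
  qed
  then show ?case
    by (intro exI[of _ "\<lambda>i. b2 i - b1 i"]) (auto simp: b1_def b2_def b(1))
qed

lemma fdiff_sum_left: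
  "fdiff m v (\<lambda>x. \<Sum>j\<in>J. c j * g j x) x = (\<Sum>j\<in>J. c j * fdiff m v (g j) x)"
  by (induction m arbitrary: x) (simp_all add: right_diff_distrib sum_subtractf)

text \<open>Differencing commutes with the directional derivative along \<open>v\<close>.\<close>

lemma DERIV_fdiff:
  fixes x v :: "real^'n"
  assumes "open S" "Ck_on 1 S f"
    and "\<And>i. i \<le> m \<Longrightarrow> x + s *\<^sub>R v + real i *\<^sub>R v \<in> S"
  shows "((\<lambda>s. fdiff m v f (x + s *\<^sub>R v)) has_real_derivative
           fdiff m v (\<lambda>y. \<Sum>j\<in>UNIV. v $ j * partial j f y) (x + s *\<^sub>R v)) (at s)"
  using assms(3)
proof (induction m arbitrary: x)
  case 0
  then have "x + s *\<^sub>R v \<in> S" by fastforce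
  from has_derivative_partials[OF assms(1,2) this]
  have "((\<lambda>s. f (x + s *\<^sub>R v)) has_derivative
      (\<lambda>t. \<Sum>j\<in>UNIV. (t *\<^sub>R v) $ j * partial j f (x + s *\<^sub>R v))) (at s)"
    by (rule has_derivative_compose[rotated]) (auto intro!: derivative_eq_intros)
  moreover have "(\<lambda>t. \<Sum>j\<in>UNIV. (t *\<^sub>R v) $ j * partial j f (x + s *\<^sub>R v))
      = (*) (\<Sum>j\<in>UNIV. v $ j * partial j f (x + s *\<^sub>R v))"
    by (auto simp: sum_distrib_left algebra_simps fun_eq_iff)
  ultimately show ?case
    by (simp add: has_field_derivative_def)
next
  case (Suc m)
  have "x + v + s *\<^sub>R v + real i *\<^sub>R v \<in> S" if "i \<le> m" for i
    using Suc.prems[of "Suc i"] that by (simp add: algebra_simps)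
  moreover have "x + s *\<^sub>R v + real i *\<^sub>R v \<in> S" if "i \<le> m" for i
    using Suc.prems[of i] that by simp
  ultimately have "((\<lambda>s. fdiff m v f (x + v + s *\<^sub>R v) - fdiff m v f (x + s *\<^sub>R v)) has_real_derivative
      fdiff m v (\<lambda>y. \<Sum>j\<in>UNIV. v $ j * partial j f y) (x + v + s *\<^sub>R v)
      - fdiff m v (\<lambda>y. \<Sum>j\<in>UNIV. v $ j * partial j f y) (x + s *\<^sub>R v)) (at s)"
    by (intro DERIV_diff Suc.IH)
  then show ?case by (simp add: algebra_simps)
qed

text \<open>A difference of order m + 1 is the increment of one of order m along \<open>v\<close>.
  The mean value theorem turns it into an m-th difference of the directional derivative, at the cost
  of a factor \<open>CARD('n) * norm v\<close>.\<close>

lemma abs_fdiff_le: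
  fixes x v :: "real^'n"
  assumes "open S" "convex S" "Ck_on m S f"
    and "\<And>js y. length js = m \<Longrightarrow> y \<in> S \<Longrightarrow> \<bar>foldr partial js f y\<bar> \<le> M"
    and "x \<in> S" "x + real m *\<^sub>R v \<in> S"
  shows "\<bar>fdiff m v f x\<bar> \<le> (real CARD('n) * norm v) ^ m * M"
  using assms(3-)
proof (induction m arbitrary: f x)
  case 0
  then show ?case using "0.prems"(2)[of "[]" x] by simp
next
  case (Suc m)
  have seg: "x + t *\<^sub>R v \<in> S" if "0 \<le> t" "t \<le> real (Suc m)" for t
  proof -
    have "x + t *\<^sub>R v = (1 - t / Suc m) *\<^sub>R x + (t / Suc m) *\<^sub>R (x + real (Suc m) *\<^sub>R v)"
      by (simp add: algebra_simps del: of_nat_Suc)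
    also have "\<dots> \<in> S"
      using that Suc.prems by (intro convexD[OF assms(2)]) auto
    finally show ?thesis .
  qed
  have C1: "Ck_on 1 S f" using Suc.prems(1) by (rule Ck_on_mono) simp
  have "((\<lambda>s. fdiff m v f (x + s *\<^sub>R v)) has_real_derivative
      fdiff m v (\<lambda>y. \<Sum>j\<in>UNIV. v $ j * partial j f y) (x + s *\<^sub>R v)) (at s)"
    if "s \<in> closed_segment 0 1" for s
  proof (rule DERIV_fdiff[OF assms(1) C1])
    fix i assume "i \<le> m"
    then show "x + s *\<^sub>R v + real i *\<^sub>R v \<in> S"
      using seg[of "s + real i"] that by (auto simp: closed_segment_eq_real_ivl algebra_simps)
  qed
  from mvt_closed_segment[of 0 1, OF this] obtain s where s: "0 \<le> s" "s \<le> 1"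
    "fdiff (Suc m) v f x = fdiff m v (\<lambda>y. \<Sum>j\<in>UNIV. v $ j * partial j f y) (x + s *\<^sub>R v)"
    by (auto simp: closed_segment_eq_real_ivl)
  have IH: "\<bar>fdiff m v (partial j f) (x + s *\<^sub>R v)\<bar> \<le> (real CARD('n) * norm v) ^ m * M" for j
  proof (rule Suc.IH)
    show "Ck_on m S (partial j f)" using Suc.prems(1) by simp
    \<comment> \<open>\<open>foldr\<close> applies the last letter first, so the derivative already
      taken is appended at the end of the word.\<close>
    show "\<bar>foldr partial js (partial j f) y\<bar> \<le> M" if "length js = m" "y \<in> S" for js y
      using Suc.prems(2)[of "js @ [j]" y] that by simp
    show "x + s *\<^sub>R v \<in> S" using s by (intro seg) auto
    show "x + s *\<^sub>R v + real m *\<^sub>R v \<in> S"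
      using seg[of "s + real m"] s by (simp add: algebra_simps)
  qed
  have "\<bar>fdiff (Suc m) v f x\<bar> \<le> (\<Sum>j\<in>UNIV. \<bar>v $ j * fdiff m v (partial j f) (x + s *\<^sub>R v)\<bar>)"
    unfolding s(3) fdiff_sum_left by (rule sum_abs)
  also have "\<dots> \<le> (\<Sum>j\<in>(UNIV::'n set). norm v * ((real CARD('n) * norm v) ^ m * M))"
    unfolding abs_mult by (intro sum_mono mult_mono IH component_le_norm_cart) auto
  finally show ?case by (simp add: algebra_simps)
qed

subsection \<open>The Dirichlet kernel as an algebraic polynomial\<close>

text \<open>The polynomial D with D(sin^2 x) = sin((2n+1)x) / sin x, which is the Dirichlet kernel
  at 2x. The recursion comes from sin(y + 2x) + sin(y - 2x) = 2 cos(2x) sin y with cos(2x) = 1 - 2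
  sin^2 x.\<close>

fun dirichlet_poly :: "nat \<Rightarrow> real poly" where
  "dirichlet_poly 0 = 1"
| "dirichlet_poly (Suc 0) = [:3, -4:]"
| "dirichlet_poly (Suc (Suc n)) = [:2, -4:] * dirichlet_poly (Suc n) - dirichlet_poly n"

lemma degree_dirichlet_poly: "degree (dirichlet_poly n) \<le> n"
proof (induction n rule: dirichlet_poly.induct)
  case (3 n)
  have "degree ([:2, -4:] * dirichlet_poly (Suc n)) \<le> 1 + Suc n"
    by (rule order_trans[OF degree_mult_le]) (use 3 in auto)
  then show ?case
    using 3 by (auto intro!: degree_diff_le simp del: mult_pCons_left)
qed auto

lemma poly_dirichlet_poly_sin:
  "poly (dirichlet_poly n) ((sin x)\<^sup>2) * sin x = sin ((2 * real n + 1) * x)"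
proof (induction n rule: dirichlet_poly.induct)
  case 2
  have "sin (2 * x + x) = (3 - 4 * (sin x)\<^sup>2) * sin x"
    unfolding sin_add sin_double cos_double_sin
    using sin_cos_squared_add[of x] by (simp add: power2_eq_square) algebra
  then show ?case by (simp add: algebra_simps)
next
  case (3 n)
  let ?y = "(2 * real (Suc n) + 1) * x"
  have "sin (?y + 2 * x) + sin (?y - 2 * x) = 2 * cos (2 * x) * sin ?y"
    by (simp add: sin_add sin_diff)
  moreover have "(2 * real (Suc (Suc n)) + 1) * x = ?y + 2 * x" "(2 * real n + 1) * x = ?y - 2 * x"
    by (simp_all add: algebra_simps)
  ultimately have "sin ((2 * real (Suc (Suc n)) + 1) * x)
      = (2 - 4 * (sin x)\<^sup>2) * sin ?y - sin ((2 * real n + 1) * x)"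
    by (simp only: cos_double_sin) (simp add: algebra_simps)
  then show ?case
    unfolding 3[symmetric] by (simp add: algebra_simps)
qed simp

lemma poly_dirichlet_poly_0: "poly (dirichlet_poly n) 0 = 2 * real n + 1"
  by (induction n rule: dirichlet_poly.induct) auto

text \<open>For s = sin x the polynomial times s is again a sine.\<close>

lemma abs_poly_dirichlet_poly_le:
  assumes "0 < s" "s \<le> 1"
  shows "\<bar>poly (dirichlet_poly n) (s\<^sup>2)\<bar> \<le> 1 / s"
proof -
  have "\<bar>poly (dirichlet_poly n) (s\<^sup>2)\<bar> * s = \<bar>sin ((2 * real n + 1) * arcsin s)\<bar>"
    unfolding poly_dirichlet_poly_sin[of n "arcsin s", symmetric] using assms by (simp add: abs_mult)
  also have "\<dots> \<le> 1" by simp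
  finally show ?thesis using assms by (simp add: field_simps)
qed

text \<open>The slope of sin on [0, 1] is at least cos(pi/3) = 1/2, because pi/3 > 1.\<close>

lemma half_le_sin:
  fixes x :: real
  assumes "0 \<le> x" "x \<le> 1"
  shows "x / 2 \<le> sin x"
proof -
  have "\<exists>z\<in>{0..x}. sin x = x * cos z"
  proof (cases "x = 0")
    case False
    then obtain z where "0 < z" "z < x" "sin x - sin 0 = (x - 0) * cos z"
      using MVT2[of 0 x sin cos] assms by auto
    then show ?thesis by (intro bexI[of _ z]) auto
  qed auto
  then obtain z where z: "0 \<le> z" "z \<le> x" "sin x = x * cos z" by auto
  have "cos (pi / 3) \<le> cos z"
    using z assms pi_gt3 by (intro cos_monotone_0_pi_le) auto
  then show ?thesis
    using z assms mult_left_mono[of "1/2" "cos z" x] by (simp add: cos_60)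
qed

text \<open>Half of the value 2n+1 at 0 persists for s up to order 1/n: with s = sin x and N = 2n+1
  one has N x \<le> 1, hence sin(N x) \<ge> N x / 2 \<ge> N s / 2.\<close>

lemma poly_dirichlet_poly_ge:
  assumes "0 \<le> s" "s \<le> 1 / (2 * (2 * real n + 1))"
  shows "(2 * real n + 1) / 2 \<le> poly (dirichlet_poly n) (s\<^sup>2)"
proof (cases "s = 0")
  case False
  define N where "N = 2 * real n + 1"
  define x where "x = arcsin s"
  have N: "N \<ge> 1" by (simp add: N_def)
  \<comment> \<open>\<open>half_le_sin\<close> at 1/N gives sin(1/N) \<ge> 1/(2N) \<ge> s, which
    makes the arcsine at most 1/N.\<close>
  have "s \<le> sin (1 / N)"
    using assms half_le_sin[of "1 / N"] N by (simp add: N_def)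
  moreover have "1 / N \<le> 1" using N by simp
  then have pi: "1 / N \<le> pi / 2" using pi_gt3 by linarith
  ultimately have "x \<le> arcsin (sin (1 / N))"
    unfolding x_def using assms by (intro arcsin_le_arcsin) auto
  also have "\<dots> = 1 / N"
    using pi N by (intro arcsin_sin) (auto intro: order_trans[of _ 0])
  finally have xN: "N * x \<le> 1" using N by (simp add: field_simps)
  have s1: "s \<le> 1"
    using \<open>s \<le> sin (1 / N)\<close> sin_le_one order_trans by blast
  have sx: "sin x = s" using assms s1 by (simp add: x_def)
  have x0: "x > 0"
    using arcsin_less_arcsin[of 0 s] assms s1 False by (simp add: x_def)
  have "N * x / 2 \<le> sin (N * x)"
    using x0 xN N by (intro half_le_sin) auto
  also have "\<dots> = poly (dirichlet_poly n) (s\<^sup>2) * s"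
    using poly_dirichlet_poly_sin[of n x] sx by (simp add: N_def)
  finally have *: "N * x / 2 \<le> poly (dirichlet_poly n) (s\<^sup>2) * s" .
  have "s \<le> x" using sin_x_le_x[of x] x0 sx by simp
  then have "N / 2 * s \<le> N * x / 2" using N by (simp add: field_simps)
  then have "N / 2 * s \<le> poly (dirichlet_poly n) (s\<^sup>2) * s"
    using * by linarith
  then show ?thesis
    using False assms by (simp add: N_def)
qed (simp add: poly_dirichlet_poly_0)

text \<open>Halving the norm brings all t with norm up to 2 into the range s \<le> 1 of the kernel
  bounds. The even exponent gives nonnegativity, and the squared norm keeps the kernel polynomial in
  the coordinates.\<close>

definition ball_kernel :: "nat \<Rightarrow> nat \<Rightarrow> 'a::real_inner \<Rightarrow> real" where
  "ball_kernel M r t = poly (dirichlet_poly M) ((norm t)\<^sup>2 / 4) ^ (2 * r)"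

lemma ball_kernel_nonneg: "0 \<le> ball_kernel M r t"
  by (simp add: ball_kernel_def)

lemma continuous_ball_kernel [continuous_intros]:
  "continuous_on S f \<Longrightarrow> continuous_on S (\<lambda>x. ball_kernel M r (f x))"
  unfolding ball_kernel_def by (intro continuous_intros) auto

lemma ball_kernel_le:
  assumes "0 < \<delta>" "\<delta> \<le> norm t" "norm t \<le> 2"
  shows "ball_kernel M r t \<le> (2 / \<delta>) ^ (2 * r)"
proof -
  have "\<bar>poly (dirichlet_poly M) ((norm t / 2)\<^sup>2)\<bar> \<le> 1 / (norm t / 2)"
    using assms by (intro abs_poly_dirichlet_poly_le) auto
  also have "\<dots> \<le> 2 / \<delta>"
    using assms by (simp add: frac_le)
  finally have "\<bar>poly (dirichlet_poly M) ((norm t / 2)\<^sup>2)\<bar> ^ (2 * r) \<le> (2 / \<delta>) ^ (2 * r)"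
    by (intro power_mono) auto
  then show ?thesis
    by (simp add: ball_kernel_def power_even_abs power_divide)
qed

lemma ball_kernel_ge:
  assumes "norm t \<le> 1 / (2 * real M + 1)"
  shows "((2 * real M + 1) / 2) ^ (2 * r) \<le> ball_kernel M r t"
proof -
  have "(2 * real M + 1) / 2 \<le> poly (dirichlet_poly M) ((norm t / 2)\<^sup>2)"
    using assms by (intro poly_dirichlet_poly_ge) (auto simp: field_simps)
  from power_mono[OF this, of "2 * r"] show ?thesis
    by (simp add: ball_kernel_def power_divide)
qed

subsection \<open>Polynomials with continuous coefficients\<close>

lemma mi_order_add: "mi_order (\<lambda>j. \<alpha> j + \<beta> j) = mi_order \<alpha> + mi_order \<beta>"
  by (simp add: mi_order_def sum.distrib)

definition mi_power :: "real^'n \<Rightarrow> ('n::finite \<Rightarrow> nat) \<Rightarrow> real" where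
  "mi_power x \<alpha> = (\<Prod>j\<in>UNIV. (x $ j) ^ \<alpha> j)"

lemma mi_power_add: "mi_power x (\<lambda>j. \<alpha> j + \<beta> j) = mi_power x \<alpha> * mi_power x \<beta>"
  by (simp add: mi_power_def power_add prod.distrib)

lemma mi_power_scaleR: "mi_power (c *\<^sub>R x) \<alpha> = c ^ mi_order \<alpha> * mi_power x \<alpha>"
  by (simp add: mi_power_def mi_order_def power_mult_distrib prod.distrib power_sum)

lemma poly_space_iff:
  "p \<in> poly_space n \<longleftrightarrow> (\<exists>c. p = (\<lambda>x. \<Sum>\<alpha> | mi_order \<alpha> \<le> n. c \<alpha> * mi_power x \<alpha>))"
  by (simp add: poly_space_def mi_power_def)

text \<open>Polynomials in \<open>x\<close> with coefficients continuous in a parameter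
  \<open>y\<close>, so that integration over \<open>y\<close> leaves a polynomial in
  \<open>x\<close>. With a dummy real parameter the same closure rules serve
  \<open>poly_space\<close>.\<close>

definition coeff_poly_space :: "nat \<Rightarrow> ('a::topological_space \<Rightarrow> real^'n \<Rightarrow> real) set" where
  "coeff_poly_space n = {F. \<exists>c. (\<forall>\<alpha>. continuous_on UNIV (c \<alpha>)) \<and>
     F = (\<lambda>y x. \<Sum>\<alpha> | mi_order \<alpha> \<le> n. c \<alpha> y * mi_power x \<alpha>)}"

lemma coeff_poly_spaceD: "F \<in> coeff_poly_space n \<Longrightarrow> F y \<in> poly_space n"
  unfolding coeff_poly_space_def poly_space_iff by auto

lemma coeff_poly_space_monomial:
  fixes \<alpha> :: "'n::finite \<Rightarrow> nat" and c :: "'a::topological_space \<Rightarrow> real"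
  assumes "continuous_on UNIV c" "mi_order \<alpha> \<le> n"
  shows "(\<lambda>y x. c y * mi_power x \<alpha>) \<in> coeff_poly_space n"
proof -
  have "(\<Sum>\<beta> | mi_order \<beta> \<le> n. (if \<beta> = \<alpha> then c y else 0) * mi_power x \<beta>)
      = (\<Sum>\<beta> | mi_order \<beta> \<le> n. if \<beta> = \<alpha> then c y * mi_power x \<beta> else 0)" for x y
    by (intro sum.cong) auto
  then have "(\<Sum>\<beta> | mi_order \<beta> \<le> n. (if \<beta> = \<alpha> then c y else 0) * mi_power x \<beta>)
      = c y * mi_power x \<alpha>" for x y
    using assms(2) by (simp add: sum.delta[OF finite_mi_order_le])
  moreover have "continuous_on UNIV (\<lambda>y. if \<beta> = \<alpha> then c y else 0)" for \<beta>
    using assms(1) by (cases "\<beta> = \<alpha>") auto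
  ultimately show ?thesis
    unfolding coeff_poly_space_def by (auto intro!: exI[of _ "\<lambda>\<beta> y. if \<beta> = \<alpha> then c y else 0"])
qed

lemma coeff_poly_space_add:
  assumes "F \<in> coeff_poly_space n" "G \<in> coeff_poly_space n"
  shows "(\<lambda>y x. F y x + G y x) \<in> coeff_poly_space n"
proof -
  obtain b c where b: "\<And>\<alpha>. continuous_on UNIV (b \<alpha>)"
    "F = (\<lambda>y x. \<Sum>\<alpha> | mi_order \<alpha> \<le> n. b \<alpha> y * mi_power x \<alpha>)"
    and c: "\<And>\<alpha>. continuous_on UNIV (c \<alpha>)"
    "G = (\<lambda>y x. \<Sum>\<alpha> | mi_order \<alpha> \<le> n. c \<alpha> y * mi_power x \<alpha>)"
    using assms unfolding coeff_poly_space_def by blast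
  show ?thesis
    unfolding coeff_poly_space_def b(2) c(2)
    by (intro CollectI exI[of _ "\<lambda>\<alpha> y. b \<alpha> y + c \<alpha> y"])
      (auto intro!: continuous_intros b(1) c(1) simp: sum.distrib distrib_right)
qed

lemma coeff_poly_space_const:
  assumes "continuous_on UNIV c"
  shows "(\<lambda>y x. c y) \<in> coeff_poly_space n"
  using coeff_poly_space_monomial[OF assms, of "\<lambda>_. 0" n] by (simp add: mi_order_def mi_power_def)

lemma coeff_poly_space_sum:
  assumes "\<And>i. i \<in> I \<Longrightarrow> F i \<in> coeff_poly_space n"
  shows "(\<lambda>y x. \<Sum>i\<in>I. F i y x) \<in> coeff_poly_space n"
  using assms
proof (induction I rule: infinite_finite_induct)
  case (insert i I)
  then show ?case by (simp add: coeff_poly_space_add)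
qed (simp_all add: coeff_poly_space_const)

lemma coeff_poly_space_mult:
  assumes "F \<in> coeff_poly_space m" "G \<in> coeff_poly_space n" "m + n \<le> l"
  shows "(\<lambda>y x. F y x * G y x) \<in> coeff_poly_space l"
proof -
  obtain b c where b: "\<And>\<alpha>. continuous_on UNIV (b \<alpha>)"
    "F = (\<lambda>y x. \<Sum>\<alpha> | mi_order \<alpha> \<le> m. b \<alpha> y * mi_power x \<alpha>)"
    and c: "\<And>\<alpha>. continuous_on UNIV (c \<alpha>)"
    "G = (\<lambda>y x. \<Sum>\<alpha> | mi_order \<alpha> \<le> n. c \<alpha> y * mi_power x \<alpha>)"
    using assms unfolding coeff_poly_space_def by blast
  have "(\<lambda>y x. F y x * G y x) = (\<lambda>y x. \<Sum>\<alpha> | mi_order \<alpha> \<le> m. \<Sum>\<beta> | mi_order \<beta> \<le> n.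
      (b \<alpha> y * c \<beta> y) * mi_power x (\<lambda>j. \<alpha> j + \<beta> j))"
    by (simp add: b(2) c(2) sum_product mi_power_add algebra_simps)
  also have "\<dots> \<in> coeff_poly_space l"
    using assms(3)
    by (intro coeff_poly_space_sum coeff_poly_space_monomial continuous_intros b(1) c(1))
      (auto simp: mi_order_add)
  finally show ?thesis .
qed

lemma coeff_poly_space_power:
  assumes "F \<in> coeff_poly_space n" "n * k \<le> l"
  shows "(\<lambda>y x. F y x ^ k) \<in> coeff_poly_space l"
proof -
  have "(\<lambda>y x. F y x ^ k) \<in> coeff_poly_space (n * k)"
  proof (induction k)
    case (Suc k)
    then show ?case using coeff_poly_space_mult[OF assms(1) Suc, of "n * Suc k"] by simp
  qed (simp add: coeff_poly_space_const)
  \<comment> \<open>Multiplying by the constant 1 relaxes the degree bound from \<open>n * k\<close>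
    to \<open>l\<close>.\<close>
  then show ?thesis
    using coeff_poly_space_mult[OF _ coeff_poly_space_const[of "\<lambda>_. 1" 0], of _ "n * k" l] assms(2)
    by simp
qed

lemma coeff_poly_space_poly:
  assumes "F \<in> coeff_poly_space n" "degree p \<le> k" "n * k \<le> l"
  shows "(\<lambda>y x. poly p (F y x)) \<in> coeff_poly_space l"
proof -
  have "(\<lambda>y x. poly p (F y x)) = (\<lambda>y x. \<Sum>i\<le>degree p. coeff p i * F y x ^ i)"
    by (simp add: poly_altdef)
  also have "\<dots> \<in> coeff_poly_space l"
  proof (intro coeff_poly_space_sum coeff_poly_space_mult[where m = 0 and n = l]
      coeff_poly_space_const coeff_poly_space_power[OF assms(1)])
    fix i assume "i \<in> {..degree p}"
    then have "i \<le> k" using assms(2) by simp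
    then show "n * i \<le> l" using mult_le_mono2[of i k n] assms(3) by linarith
  qed auto
  finally show ?thesis .
qed

lemma mi_order_single: "mi_order (\<lambda>i. if i = j then 1 else 0) = 1"
  by (simp add: mi_order_def)

lemma mi_power_single: "mi_power x (\<lambda>i. if i = j then 1 else 0) = x $ j"
proof -
  have "mi_power x (\<lambda>i. if i = j then 1 else 0) = (\<Prod>i\<in>UNIV. if i = j then x $ i else 1)"
    unfolding mi_power_def by (intro prod.cong) auto
  then show ?thesis by simp
qed

lemma coeff_poly_space_norm_affine:
  fixes f :: "'a::topological_space \<Rightarrow> real^'n"
  assumes "continuous_on UNIV f"
  shows "(\<lambda>y x. (norm (f y + a *\<^sub>R x))\<^sup>2) \<in> coeff_poly_space 2"
proof -
  have "(\<lambda>y x. (norm (f y + a *\<^sub>R x))\<^sup>2) = (\<lambda>y x. \<Sum>j\<in>UNIV. (f y $ j + a * x $ j) ^ 2)"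
    by (simp add: norm_vec_def L2_set_def sum_nonneg)
  also have "\<dots> \<in> coeff_poly_space 2"
  proof (intro coeff_poly_space_sum coeff_poly_space_power[where n = 1] coeff_poly_space_add
      coeff_poly_space_const)
    fix j
    show "continuous_on UNIV (\<lambda>y. f y $ j)" using assms by (intro continuous_intros)
    show "(\<lambda>y x. a * x $ j) \<in> coeff_poly_space 1"
      using coeff_poly_space_monomial[of "\<lambda>_. a" "\<lambda>i. if i = j then 1 else 0" 1]
      by (simp only: mi_order_single mi_power_single) simp
  qed auto
  finally show ?thesis .
qed

text \<open>Degree count: the squared norm has degree 2 in \<open>x\<close>, the Dirichlet
  polynomial at most \<open>M\<close>, and the outer power is \<open>2 * r\<close>.\<close>

lemma coeff_poly_space_ball_kernel:
  "(\<lambda>y x. ball_kernel M r (c *\<^sub>R (y - a *\<^sub>R x))) \<in> coeff_poly_space (4 * r * M)"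
proof -
  have "(\<lambda>y x. (norm (c *\<^sub>R y + (- c * a) *\<^sub>R x))\<^sup>2 * (1 / 4)) \<in> coeff_poly_space 2"
    by (intro coeff_poly_space_mult[where m = 2 and n = 0] coeff_poly_space_norm_affine
        coeff_poly_space_const continuous_intros) auto
  then have "(\<lambda>y x. (norm (c *\<^sub>R (y - a *\<^sub>R x)))\<^sup>2 / 4) \<in> coeff_poly_space 2"
    by (simp add: algebra_simps)
  then have "(\<lambda>y x. poly (dirichlet_poly M) ((norm (c *\<^sub>R (y - a *\<^sub>R x)))\<^sup>2 / 4)) \<in> coeff_poly_space (2 * M)"
    by (rule coeff_poly_space_poly[OF _ degree_dirichlet_poly]) simp
  then show ?thesis
    unfolding ball_kernel_def by (rule coeff_poly_space_power) simp
qed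

text \<open>The monomials do not involve \<open>y\<close>, so the integral acts on the coefficients
  alone; these are integrable, being continuous on a compact ball.\<close>

lemma poly_space_integral:
  fixes u :: "real^'n \<Rightarrow> real"
  assumes "F \<in> coeff_poly_space n" "continuous_on (cball 0 1) u"
  shows "(\<lambda>x. LINT y:cball 0 1|lborel. u y * F y x) \<in> poly_space n"
proof -
  obtain c where c: "\<And>\<alpha>. continuous_on UNIV (c \<alpha>)"
    "F = (\<lambda>y x. \<Sum>\<alpha> | mi_order \<alpha> \<le> n. c \<alpha> y * mi_power x \<alpha>)"
    using assms(1) unfolding coeff_poly_space_def by blast
  have int: "integrable lborel (\<lambda>y. indicator (cball 0 1) y *\<^sub>R (u y * c \<alpha> y))" for \<alpha>
    by (intro borel_integrable_compact continuous_intros assms(2) continuous_on_subset[OF c(1)]) auto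
  have "(LINT y:cball 0 1|lborel. u y * F y x)
      = (\<Sum>\<alpha> | mi_order \<alpha> \<le> n. (LINT y:cball 0 1|lborel. u y * c \<alpha> y) * mi_power x \<alpha>)" for x
  proof -
    have "(LINT y:cball 0 1|lborel. u y * F y x) = (LINT y|lborel. (\<Sum>\<alpha> | mi_order \<alpha> \<le> n.
        (indicator (cball 0 1) y *\<^sub>R (u y * c \<alpha> y)) * mi_power x \<alpha>))"
      by (simp add: set_lebesgue_integral_def c(2) sum_distrib_left algebra_simps)
    also have "\<dots> = (\<Sum>\<alpha> | mi_order \<alpha> \<le> n. (LINT y:cball 0 1|lborel. u y * c \<alpha> y) * mi_power x \<alpha>)"
      unfolding set_lebesgue_integral_def
      by (subst Bochner_Integration.integral_sum) (intro integrable_mult_left int, simp)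
    finally show ?thesis .
  qed
  then show ?thesis
    unfolding poly_space_iff by (intro exI ext)
qed

section \<open>Closure properties and degree monotonicity of the polynomial spaces\<close>

lemma poly_space_sum:
  assumes "\<And>i. i \<in> I \<Longrightarrow> p i \<in> poly_space n"
  shows "(\<lambda>x. \<Sum>i\<in>I. a i * p i x) \<in> poly_space n"
proof -
  have "\<forall>i. \<exists>c. i \<in> I \<longrightarrow> p i = (\<lambda>x. \<Sum>\<alpha> | mi_order \<alpha> \<le> n. c \<alpha> * mi_power x \<alpha>)"
    using assms unfolding poly_space_iff by blast
  then obtain c where c: "\<And>i. i \<in> I \<Longrightarrow> p i = (\<lambda>x. \<Sum>\<alpha> | mi_order \<alpha> \<le> n. c i \<alpha> * mi_power x \<alpha>)"
    unfolding choice_iff by blast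
  have "(\<Sum>i\<in>I. a i * p i x) = (\<Sum>\<alpha> | mi_order \<alpha> \<le> n. (\<Sum>i\<in>I. a i * c i \<alpha>) * mi_power x \<alpha>)" for x
    by (simp add: c sum_distrib_left sum_distrib_right mult.assoc) (rule sum.swap)
  then show ?thesis
    unfolding poly_space_iff by (intro exI ext)
qed

lemma continuous_poly_space: "p \<in> poly_space n \<Longrightarrow> continuous_on S p"
  unfolding poly_space_def by (auto intro!: continuous_intros)

lemma poly_space_mono:
  assumes "p \<in> poly_space m" "m \<le> n"
  shows "p \<in> poly_space n"
proof -
  obtain c where c: "p = (\<lambda>x. \<Sum>\<alpha> | mi_order \<alpha> \<le> m. c \<alpha> * mi_power x \<alpha>)"
    using assms(1) unfolding poly_space_iff by blast
  have "(\<lambda>(y::real) x. p x) \<in> coeff_poly_space m"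
    unfolding c by (intro coeff_poly_space_sum coeff_poly_space_monomial) auto
  from coeff_poly_space_mult[OF this coeff_poly_space_const[of "\<lambda>_. 1" 0], of n]
  have "(\<lambda>(y::real) x. p x) \<in> coeff_poly_space n"
    using assms(2) by simp
  then show ?thesis by (rule coeff_poly_spaceD)
qed

lemma vanishing_poly_space_mono:
  "q \<in> vanishing_poly_space m \<Longrightarrow> m \<le> n \<Longrightarrow> q \<in> vanishing_poly_space n"
  unfolding vanishing_poly_space_def by (auto dest: poly_space_mono)

lemma zero_in_vanishing_poly_space: "(\<lambda>_. 0) \<in> vanishing_poly_space n"
proof -
  have "(\<lambda>_. 0) \<in> poly_space n"
    unfolding poly_space_iff by (rule exI[of _ "\<lambda>_. 0"]) simp
  then show ?thesis
    unfolding vanishing_poly_space_def by (intro CollectI exI[of _ "\<lambda>_. 0"]) simp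
qed

subsection \<open>Correction on the sphere\<close>

text \<open>At x = \<rho> \<xi> with \<open>norm \<xi> = 1\<close>, the remainder P - q is
  \<rho>^(2L) times the even part of P at \<xi> plus \<rho> times the odd part. That sum is a convex
  combination of P(\<xi>) and P(-\<xi>), so the bound on the sphere passes to the ball without
  loss.\<close>

lemma homogeneous_correction:
  fixes P :: "real^'n \<Rightarrow> real"
  assumes "P \<in> poly_space (2 * L)" "\<And>x. x \<in> sphere 0 1 \<Longrightarrow> \<bar>P x\<bar> \<le> e"
  shows "\<exists>q\<in>vanishing_poly_space (2 * L). \<forall>x\<in>cball 0 1. \<bar>P x - q x\<bar> \<le> e"
proof -
  let ?A = "{\<alpha> :: 'n \<Rightarrow> nat. mi_order \<alpha> \<le> 2 * L}"
  obtain c where P: "P = (\<lambda>x. \<Sum>\<alpha>\<in>?A. c \<alpha> * mi_power x \<alpha>)"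
    using assms(1) unfolding poly_space_iff by blast
  \<comment> \<open>Monomials of even order are raised to degree 2L, those of odd order to degree 2L
    + 1.\<close>
  define par where "par \<alpha> = (if even (mi_order \<alpha>) then 0 else 1 :: nat)" for \<alpha> :: "'n \<Rightarrow> nat"
  define k where "k \<alpha> = (2 * L + par \<alpha> - mi_order \<alpha>) div 2" for \<alpha> :: "'n \<Rightarrow> nat"
  have k: "mi_order \<alpha> + 2 * k \<alpha> = 2 * L + par \<alpha>" if "\<alpha> \<in> ?A" for \<alpha>
    using that by (auto simp: k_def par_def)
  \<comment> \<open>The geometric sum is the quotient of
    \<open>1 - ((norm x)\<^sup>2) ^ k \<alpha>\<close> by
    \<open>1 - (norm x)\<^sup>2\<close>.\<close>
  define p where "p x = (\<Sum>\<alpha>\<in>?A. c \<alpha> * mi_power x \<alpha> * (\<Sum>l<k \<alpha>. ((norm x)\<^sup>2) ^ l))" for x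
  have "(\<lambda>(y::real) x. c \<alpha> * mi_power x \<alpha> * (\<Sum>l<k \<alpha>. ((norm x)\<^sup>2) ^ l)) \<in> coeff_poly_space (2 * L)"
    if "\<alpha> \<in> ?A" for \<alpha>
  proof (cases "k \<alpha> = 0")
    case True
    then show ?thesis by (simp add: coeff_poly_space_const)
  next
    case False
    have "par \<alpha> \<le> 1" by (simp add: par_def)
    \<comment> \<open>The sum ends at exponent \<open>k \<alpha> - 1\<close>, which keeps the degree
      within 2L although odd monomials are raised to 2L + 1.\<close>
    then have le: "mi_order \<alpha> + 2 * (k \<alpha> - 1) \<le> 2 * L" using k[OF that] False by linarith
    have "(\<lambda>(y::real) x::real^'n. (norm x)\<^sup>2) \<in> coeff_poly_space 2"
      using coeff_poly_space_norm_affine[of "\<lambda>_::real. 0" 1] by simp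
    then show ?thesis
      by (intro coeff_poly_space_mult[OF _ _ le] coeff_poly_space_monomial
          coeff_poly_space_sum coeff_poly_space_power[where n = 2 and F = "\<lambda>_ x. (norm x)\<^sup>2"]) auto
  qed
  then have "(\<lambda>(y::real) x. p x) \<in> coeff_poly_space (2 * L)"
    unfolding p_def by (intro coeff_poly_space_sum) auto
  then have "p \<in> poly_space (2 * L)"
    by (rule coeff_poly_spaceD)
  then have "(\<lambda>x. (1 - (norm x)\<^sup>2) * p x) \<in> vanishing_poly_space (2 * L)"
    unfolding vanishing_poly_space_def by (intro CollectI exI[of _ p] conjI refl)
  moreover have "\<bar>P x - (1 - (norm x)\<^sup>2) * p x\<bar> \<le> e" if x: "x \<in> cball 0 1" for x
  proof -
    have "(1 - (norm x)\<^sup>2) * p x = (\<Sum>\<alpha>\<in>?A. c \<alpha> * mi_power x \<alpha> * (1 - ((norm x)\<^sup>2) ^ k \<alpha>))"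
      unfolding p_def sum_distrib_left one_diff_power_eq by (simp add: algebra_simps)
    then have h: "P x - (1 - (norm x)\<^sup>2) * p x = (\<Sum>\<alpha>\<in>?A. c \<alpha> * mi_power x \<alpha> * ((norm x)\<^sup>2) ^ k \<alpha>)"
      by (simp add: P right_diff_distrib sum_subtractf)
    define \<rho> where "\<rho> = norm x"
    obtain \<xi> where \<xi>: "norm \<xi> = 1" "x = \<rho> *\<^sub>R \<xi>"
    proof (cases "x = 0")
      case True
      then show ?thesis
        using that[of "axis undefined 1"] by (simp add: \<rho>_def)
    next
      case False
      then show ?thesis
        using that[of "x /\<^sub>R norm x"] by (simp add: \<rho>_def)
    qed
    have sgn: "mi_power (- \<xi>) \<alpha> = (if even (mi_order \<alpha>) then mi_power \<xi> \<alpha> else - mi_power \<xi> \<alpha>)" for \<alpha>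
      using mi_power_scaleR[of "-1" \<xi> \<alpha>] by simp
    have "c \<alpha> * mi_power x \<alpha> * ((norm x)\<^sup>2) ^ k \<alpha>
        = \<rho> ^ (2 * L) * (c \<alpha> * mi_power \<xi> \<alpha> * \<rho> ^ par \<alpha>)" if "\<alpha> \<in> ?A" for \<alpha>
    proof -
      have "\<rho> ^ mi_order \<alpha> * (\<rho>\<^sup>2) ^ k \<alpha> = \<rho> ^ (2 * L) * \<rho> ^ par \<alpha>"
        using k[OF that] by (simp add: power_add[symmetric] power_mult[symmetric])
      then show ?thesis
        unfolding \<rho>_def[symmetric] by (simp add: \<xi>(2) mi_power_scaleR mult.assoc mult.left_commute)
    qed
    then have "P x - (1 - (norm x)\<^sup>2) * p x
        = \<rho> ^ (2 * L) * (\<Sum>\<alpha>\<in>?A. c \<alpha> * mi_power \<xi> \<alpha> * \<rho> ^ par \<alpha>)"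
      unfolding h sum_distrib_left by (intro sum.cong) auto
    \<comment> \<open>Even monomials agree at \<xi> and -\<xi> and odd ones change sign, so the
      weights (1 + \<rho>)/2 and (1 - \<rho>)/2 produce the factors 1 and \<rho>.\<close>
    also have "(\<Sum>\<alpha>\<in>?A. c \<alpha> * mi_power \<xi> \<alpha> * \<rho> ^ par \<alpha>)
        = (\<Sum>\<alpha>\<in>?A. (1 + \<rho>) / 2 * (c \<alpha> * mi_power \<xi> \<alpha>) + (1 - \<rho>) / 2 * (c \<alpha> * mi_power (- \<xi>) \<alpha>))"
      by (intro sum.cong) (auto simp: par_def sgn field_simps)
    also have "\<dots> = (1 + \<rho>) / 2 * P \<xi> + (1 - \<rho>) / 2 * P (- \<xi>)"
      by (simp add: P sum.distrib sum_distrib_left)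
    finally have eq: "P x - (1 - (norm x)\<^sup>2) * p x
        = \<rho> ^ (2 * L) * ((1 + \<rho>) / 2 * P \<xi> + (1 - \<rho>) / 2 * P (- \<xi>))" .
    have \<rho>: "0 \<le> \<rho>" "\<rho> \<le> 1" using x by (auto simp: \<rho>_def)
    have e: "\<bar>P \<xi>\<bar> \<le> e" "\<bar>P (- \<xi>)\<bar> \<le> e" using \<xi>(1) by (auto intro!: assms(2))
    have "\<bar>(1 + \<rho>) / 2 * P \<xi> + (1 - \<rho>) / 2 * P (- \<xi>)\<bar> \<le> (1 + \<rho>) / 2 * e + (1 - \<rho>) / 2 * e"
      using \<rho> e by (intro abs_triangle_ineq[THEN order_trans] add_mono)
        (auto simp: abs_mult intro!: mult_left_mono)
    also have "\<dots> = e" by (simp add: field_simps)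
    finally have "\<bar>P x - (1 - (norm x)\<^sup>2) * p x\<bar> \<le> 1 * e"
      unfolding eq abs_mult using \<rho> by (intro mult_mono) (auto simp: power_le_one)
    then show ?thesis by simp
  qed
  ultimately show ?thesis by (intro bexI ballI)
qed

section \<open>Affine substitution in Lebesgue integrals\<close>

lemma lborel_affine_integral:
  fixes f :: "'a::euclidean_space \<Rightarrow> real"
  assumes "c \<noteq> 0" "integrable lborel f"
  shows "integrable lborel (\<lambda>t. f (z + c *\<^sub>R t))"
    and "(LINT t|lborel. f (z + c *\<^sub>R t)) = (LINT y|lborel. f y) / \<bar>c\<bar> ^ DIM('a)"
proof -
  have m: "f \<in> borel_measurable borel" using borel_measurable_integrable[OF assms(2)] by simp
  have "integrable (density (distr lborel borel (\<lambda>x. z + c *\<^sub>R x)) (\<lambda>_. ennreal (\<bar>c\<bar> ^ DIM('a)))) f"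
    using assms(2) lborel_affine[OF assms(1), of z] by simp
  then show "integrable lborel (\<lambda>t. f (z + c *\<^sub>R t))"
    using m assms(1) by (subst (asm) integrable_density) (auto simp: integrable_distr_eq)
  have "(LINT y|lborel. f y)
      = (LINT y|density (distr lborel borel (\<lambda>x. z + c *\<^sub>R x)) (\<lambda>_. ennreal (\<bar>c\<bar> ^ DIM('a))). f y)"
    using lborel_affine[OF assms(1), of z] by simp
  also have "\<dots> = \<bar>c\<bar> ^ DIM('a) * (LINT t|lborel. f (z + c *\<^sub>R t))"
    using m by (subst integral_density) (auto simp: integral_distr)
  finally show "(LINT t|lborel. f (z + c *\<^sub>R t)) = (LINT y|lborel. f y) / \<bar>c\<bar> ^ DIM('a)"
    using assms(1) by simp
qed

subsection \<open>Approximation\<close>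

text \<open>On the open ball \<open>u\<close> is its own derivative along the empty word; continuity
  carries the bound to the sphere.\<close>

lemma abs_le_Ck_norm:
  fixes u :: "real^'n \<Rightarrow> real"
  assumes "Ck_cball m u" "x \<in> cball 0 1"
  shows "\<bar>u x\<bar> \<le> Ck_norm m u"
proof -
  have "continuous_on (closure (ball 0 1)) u"
    using assms(1) by (simp add: Ck_cball_def)
  moreover have "\<forall>y\<in>ball 0 1. norm (u y) \<le> Ck_norm m u"
    using abs_foldr_partial_le_Ck_norm[OF assms(1), of "[]"] by simp
  ultimately show ?thesis
    using continuous_on_closure_norm_le[of "ball 0 1" u "Ck_norm m u" x] assms(2) by simp
qed

text \<open>Keep only the ball of radius 1/N, N = 2M + 1, on which the kernel is at least
  (N/2)^(2r).\<close>

lemma ball_kernel_mean_ge: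
  "((2 * real M + 1) / 2) ^ (2 * r) * measure lborel (cball (0::real^'n) 1) / (2 * real M + 1) ^ CARD('n)
     \<le> (LINT t:cball (0::real^'n) 2|lborel. ball_kernel M r t)"
proof -
  define N where "N = 2 * real M + 1"
  define c where "c = (N / 2) ^ (2 * r)"
  have N: "N \<ge> 1" by (simp add: N_def)
  have i1: "integrable lborel (\<lambda>t::real^'n. indicator (cball 0 (1 / N)) t *\<^sub>R c)"
    by (intro borel_integrable_compact continuous_intros) auto
  have i2: "integrable lborel (\<lambda>t::real^'n. indicator (cball 0 2) t *\<^sub>R ball_kernel M r t)"
    by (intro borel_integrable_compact continuous_intros) auto
  have "measure lborel (cball (0::real^'n) (1 / N)) = (1 / N) ^ CARD('n) * measure lborel (cball (0::real^'n) 1)"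
    using content_ball_conv_unit_ball[of "1 / N" "0 :: real^'n"] N by (simp add: content_cball_conv_ball)
  then have "c * measure lborel (cball (0::real^'n) 1) / N ^ CARD('n)
      = (LINT t|lborel. indicator (cball (0::real^'n) (1 / N)) t *\<^sub>R c)"
    by (simp add: power_one_over field_simps)
  also have "\<dots> \<le> (LINT t|lborel. indicator (cball (0::real^'n) 2) t *\<^sub>R ball_kernel M r t)"
  proof (rule integral_mono[OF i1 i2])
    fix t :: "real^'n"
    have "1 / N \<le> 1" using N by simp
    then have "norm t \<le> 1 / N \<Longrightarrow> norm t \<le> 2" by linarith
    then show "indicator (cball 0 (1 / N)) t *\<^sub>R c \<le> indicator (cball 0 2) t *\<^sub>R ball_kernel M r t"
      using ball_kernel_ge[of t M r] ball_kernel_nonneg[of M r t]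
      by (auto simp: indicator_def c_def N_def)
  qed
  finally show ?thesis
    by (simp add: c_def N_def set_lebesgue_integral_def)
qed

text \<open>Since \<open>fdiff m v u x\<close> is a combination of the values \<open>u (x + i v)\<close> with coefficient \<open>\<plusminus> 1\<close> at
  \<open>i = 0\<close>, averaging it over \<open>v = t - \<delta> x\<close> with weight \<open>ball_kernel M r t\<close> expresses \<open>u x\<close> up to a small
  error by averages of \<open>u (x + i v)\<close>, \<open>i \<ge> 1\<close>, and these are polynomials in \<open>x\<close>. The shift by
  \<open>- \<delta> x\<close> keeps the points \<open>x + i v\<close> inside the ball for \<open>norm t \<le> \<delta>\<close>; for \<open>norm t > \<delta>\<close> the kernel is
  small, and \<open>u\<close> may be extended by zero.\<close>
lemma poly_space_approximation:
  fixes u :: "real^'n \<Rightarrow> real" and M r :: nat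
  defines "w \<equiv> LINT t:cball (0::real^'n) 2|lborel. ball_kernel M r t"
  assumes u: "Ck_cball m u" and \<delta>: "0 < \<delta>" "real m * \<delta> < 1" "1 \<le> m"
    and b: "b 0 = (-1) ^ m"
      "\<And>(v::real^'n) f x. fdiff m v f x = (\<Sum>i\<le>m. b i * f (x + real i *\<^sub>R v))"
  shows "\<exists>P\<in>poly_space (4 * r * M). \<forall>x\<in>ball 0 1. \<bar>u x - P x\<bar>
     \<le> ((2 * real CARD('n) * \<delta>) ^ m
        + (\<Sum>i\<le>m. \<bar>b i\<bar>) * (2 / \<delta>) ^ (2 * r) * measure lborel (cball (0::real^'n) 2) / w) * Ck_norm m u"
proof -
  let ?K = "ball_kernel M r :: real^'n \<Rightarrow> real"
  let ?U = "Ck_norm m u"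
  let ?I = "indicator (cball (0::real^'n) 2) :: real^'n \<Rightarrow> real"
  have "0 < ((2 * real M + 1) / 2) ^ (2 * r) * measure lborel (cball (0::real^'n) 1) / (2 * real M + 1) ^ CARD('n)"
    by (intro divide_pos_pos mult_pos_pos zero_less_power content_cball_pos) auto
  then have w: "w > 0" unfolding w_def using ball_kernel_mean_ge[where 'n = 'n, of M r] by linarith
  have U: "\<bar>u y\<bar> \<le> ?U" if "y \<in> cball 0 1" for y
    using abs_le_Ck_norm[OF u that] .
  have U0: "?U \<ge> 0" using U[of 0] by simp
  have cu: "continuous_on (cball 0 1) u" and Cu: "Ck_on m (ball 0 1) u"
    using u by (auto simp: Ck_cball_def)
  define v where "v y = indicator (cball 0 1) y * u y" for y
  have vU: "\<bar>v y\<bar> \<le> ?U" for y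
    using U[of y] U0 by (auto simp: v_def indicator_def)
  \<comment> \<open>The substitution y = x + i (t - \<delta> x) = (1 - i \<delta>) x + i t turns the
    average of \<open>u (x + i v)\<close> into an integral over the unit ball with Jacobian
    \<open>1 / real i ^ CARD('n)\<close>; \<open>b 0 * w\<close> is the weight of
    \<open>u x\<close>.\<close>
  define P where "P x = (\<Sum>i\<in>{1..m}. (- (b i / (b 0 * w * real i ^ CARD('n)))) *
     (LINT y:cball 0 1|lborel. u y * ?K ((1 / real i) *\<^sub>R (y - (1 - real i * \<delta>) *\<^sub>R x))))" for x
  have "P \<in> poly_space (4 * r * M)"
    unfolding P_def by (intro poly_space_sum poly_space_integral coeff_poly_space_ball_kernel cu)
  moreover have "\<bar>u x - P x\<bar> \<le> ((2 * real CARD('n) * \<delta>) ^ m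
        + (\<Sum>i\<le>m. \<bar>b i\<bar>) * (2 / \<delta>) ^ (2 * r) * measure lborel (cball (0::real^'n) 2) / w) * ?U"
    if x: "x \<in> ball 0 1" for x
  proof -
    have nx: "norm x < 1" using x by simp
    define z where "z i = (1 - real i * \<delta>) *\<^sub>R x" for i :: nat
    have id: "real i * \<delta> < 1" if "i \<le> m" for i
    proof -
      have "real i * \<delta> \<le> real m * \<delta>" using that \<delta>(1) by (intro mult_right_mono) auto
      then show ?thesis using \<delta>(2) by linarith
    qed
    have nz: "norm (z i) \<le> (1 - real i * \<delta>) * norm x" "norm (z i) \<le> 1" if "i \<le> m" for i
    proof -
      show *: "norm (z i) \<le> (1 - real i * \<delta>) * norm x" using id[OF that] by (simp add: z_def)
      have "(1 - real i * \<delta>) * norm x \<le> 1 * 1"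
        using nx id[OF that] \<delta>(1) by (intro mult_mono) auto
      then show "norm (z i) \<le> 1" using * by linarith
    qed
    define h where "h i t = ?I t * v (z i + real i *\<^sub>R t) * ?K t" for i t
    have h0: "integrable lborel (h 0)" "(LINT t|lborel. h 0 t) = w * u x"
    proof -
      have eq: "h 0 = (\<lambda>t. (?I t *\<^sub>R ?K t) * u x)"
        using nx by (auto simp: h_def z_def v_def fun_eq_iff)
      have "integrable lborel (\<lambda>t. ?I t *\<^sub>R ?K t)"
        by (intro borel_integrable_compact continuous_intros) auto
      then show "integrable lborel (h 0)" "(LINT t|lborel. h 0 t) = w * u x"
        unfolding eq w_def set_lebesgue_integral_def by simp_all
    qed
    have hi: "integrable lborel (h i)" "(LINT t|lborel. h i t)
        = (LINT y:cball 0 1|lborel. u y * ?K ((1 / real i) *\<^sub>R (y - z i))) / real i ^ CARD('n)"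
      if i: "1 \<le> i" "i \<le> m" for i
    proof -
      define f where "f y = indicator (cball 0 1) y *\<^sub>R (u y * ?K ((1 / real i) *\<^sub>R (y - z i)))" for y
      have f: "integrable lborel f"
        unfolding f_def by (intro borel_integrable_compact continuous_intros cu) auto
      \<comment> \<open>For i \<ge> 1 the cut-off at norm 2 loses nothing: beyond it the point
        \<open>z i + real i *\<^sub>R t\<close> is outside the unit ball, where \<open>f\<close>
        vanishes. Hence the substitution can be made on the whole space.\<close>
      have "h i t = f (z i + real i *\<^sub>R t)" for t
      proof (cases "norm t \<le> 2")
        case True
        then show ?thesis using i by (simp add: h_def f_def v_def)
      next
        case False
        have "norm (real i *\<^sub>R t) \<le> norm (z i + real i *\<^sub>R t) + norm (z i)"
          using norm_triangle_ineq4[of "z i + real i *\<^sub>R t" "z i"] by simp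
        moreover have "1 * norm t \<le> real i * norm t" using i by (intro mult_right_mono) auto
        ultimately have "norm (z i + real i *\<^sub>R t) > 1" using False nz(2)[OF i(2)] by simp
        then show ?thesis using False by (simp add: h_def f_def)
      qed
      then have eq: "h i = (\<lambda>t. f (z i + real i *\<^sub>R t))" by auto
      show "integrable lborel (h i)"
        unfolding eq using i by (intro lborel_affine_integral(1) f) auto
      show "(LINT t|lborel. h i t)
        = (LINT y:cball 0 1|lborel. u y * ?K ((1 / real i) *\<^sub>R (y - z i))) / real i ^ CARD('n)"
        unfolding eq using i by (subst lborel_affine_integral(2)[OF _ f]) (auto simp: f_def[abs_def] set_lebesgue_integral_def)
    qed
    have hint: "integrable lborel (h i)" if "i \<le> m" for i
      using h0 hi that by (cases "i = 0") auto
    define G where "G t = (\<Sum>i\<le>m. b i * v (z i + real i *\<^sub>R t))" for t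
    have b0: "b 0 \<noteq> 0" "\<bar>b 0\<bar> = 1" by (simp_all add: b power_abs)
    have split: "{..m} = insert 0 {1..m}" by auto
    have "b 0 * w * P x = - (\<Sum>i\<in>{1..m}. b i * (LINT t|lborel. h i t))"
      unfolding P_def sum_distrib_left sum_negf[symmetric] using w b0
      by (intro sum.cong) (auto simp: hi(2) z_def)
    \<comment> \<open>The term i = 0 contributes \<open>b 0 * w * u x\<close> and the remaining ones
      \<open>- b 0 * w * P x\<close>.\<close>
    then have "b 0 * w * (u x - P x) = (\<Sum>i\<le>m. b i * (LINT t|lborel. h i t))"
      unfolding split by (simp add: h0(2) algebra_simps)
    also have "\<dots> = (LINT t|lborel. (\<Sum>i\<le>m. b i * h i t))"
      by (subst Bochner_Integration.integral_sum) (auto intro: hint)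
    also have "(\<lambda>t. \<Sum>i\<le>m. b i * h i t) = (\<lambda>t. ?I t * G t * ?K t)"
      by (simp add: h_def G_def sum_distrib_left sum_distrib_right algebra_simps)
    finally have main: "b 0 * w * (u x - P x) = (LINT t|lborel. ?I t * G t * ?K t)" .
    \<comment> \<open>\<open>\<alpha>\<close> bounds the difference for
      \<open>norm t \<le> \<delta>\<close>; \<open>\<beta>\<close> bounds difference times kernel on
      the tail.\<close>
    define \<alpha> where "\<alpha> = (2 * real CARD('n) * \<delta>) ^ m * ?U"
    define \<beta> where "\<beta> = (\<Sum>i\<le>m. \<bar>b i\<bar>) * ?U * (2 / \<delta>) ^ (2 * r)"
    have \<alpha>\<beta>: "\<alpha> \<ge> 0" "\<beta> \<ge> 0"
      using U0 \<delta>(1) by (auto simp: \<alpha>_def \<beta>_def intro!: mult_nonneg_nonneg sum_nonneg)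
    have GK: "\<bar>G t * ?K t\<bar> \<le> \<alpha> * ?K t + \<beta>" if t: "norm t \<le> 2" for t
    proof (cases "norm t \<le> \<delta>")
      case True
      let ?v = "t - \<delta> *\<^sub>R x"
      have zt: "z i + real i *\<^sub>R t = x + real i *\<^sub>R ?v" for i
        by (simp add: z_def algebra_simps)
      \<comment> \<open>The point is a convex combination of x and t / \<delta>, and the weight 1 -
        i \<delta> of x is positive, so \<open>norm x < 1\<close> makes the bound strict.\<close>
      have inb: "x + real i *\<^sub>R ?v \<in> ball 0 1" if "i \<le> m" for i
      proof -
        have "norm (z i + real i *\<^sub>R t) \<le> (1 - real i * \<delta>) * norm x + real i * \<delta>"
          using nz(1)[OF that] True by (intro norm_triangle_mono) (auto intro: mult_left_mono)
        also have "(1 - real i * \<delta>) * norm x < (1 - real i * \<delta>) * 1"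
          using id[OF that] nx by (intro mult_strict_left_mono) auto
        finally show ?thesis by (simp add: zt)
      qed
      have "G t = fdiff m ?v u x"
        unfolding G_def b(2) zt
      proof (intro sum.cong refl)
        fix i assume "i \<in> {..m}"
        then have "x + real i *\<^sub>R ?v \<in> cball 0 1" using inb[of i] by simp
        then show "b i * v (x + real i *\<^sub>R ?v) = b i * u (x + real i *\<^sub>R ?v)"
          by (simp add: v_def)
      qed
      moreover have "\<bar>fdiff m ?v u x\<bar> \<le> (real CARD('n) * norm ?v) ^ m * ?U"
        using inb[of m] x
        by (intro abs_fdiff_le[OF _ _ Cu] abs_foldr_partial_le_Ck_norm[OF u]) auto
      moreover have "norm ?v \<le> 2 * \<delta>"
      proof -
        have "\<delta> * norm x \<le> \<delta> * 1" using nx \<delta>(1) by (intro mult_left_mono) auto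
        then have "norm (\<delta> *\<^sub>R x) \<le> \<delta>" using \<delta>(1) by simp
        then show ?thesis using True norm_triangle_ineq4[of t "\<delta> *\<^sub>R x"] by linarith
      qed
      then have "(real CARD('n) * norm ?v) ^ m * ?U \<le> \<alpha>"
        unfolding \<alpha>_def mult.commute[of 2] mult.assoc
        by (intro mult_right_mono power_mono mult_left_mono U0) auto
      ultimately have "\<bar>G t\<bar> \<le> \<alpha>" by linarith
      then show ?thesis
        using \<alpha>\<beta>(2) ball_kernel_nonneg[of M r t] mult_right_mono[of "\<bar>G t\<bar>" \<alpha> "?K t"]
        by (simp add: abs_mult)
    next
      case False
      have "\<bar>G t\<bar> \<le> (\<Sum>i\<le>m. \<bar>b i\<bar> * ?U)"
        unfolding G_def by (rule order_trans[OF sum_abs]) (auto simp: abs_mult intro!: sum_mono mult_left_mono vU)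
      then have "\<bar>G t\<bar> \<le> (\<Sum>i\<le>m. \<bar>b i\<bar>) * ?U"
        by (simp add: sum_distrib_right)
      moreover have "?K t \<le> (2 / \<delta>) ^ (2 * r)"
        using False t \<delta>(1) by (intro ball_kernel_le) auto
      ultimately have "\<bar>G t\<bar> * ?K t \<le> \<beta>"
        unfolding \<beta>_def using ball_kernel_nonneg[of M r t] U0
        by (intro mult_mono) (auto intro!: mult_nonneg_nonneg sum_nonneg)
      moreover have "0 \<le> \<alpha> * ?K t"
        using \<alpha>\<beta>(1) ball_kernel_nonneg[of M r t] by simp
      ultimately show ?thesis
        using ball_kernel_nonneg[of M r t] by (simp add: abs_mult)
    qed
    have iK: "integrable lborel (\<lambda>t. ?I t *\<^sub>R ?K t)" "integrable lborel (\<lambda>t. ?I t *\<^sub>R \<beta>)"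
      by (intro borel_integrable_compact continuous_intros; simp)+
    have "\<bar>LINT t|lborel. ?I t * G t * ?K t\<bar> \<le> (LINT t|lborel. \<alpha> * (?I t *\<^sub>R ?K t) + ?I t *\<^sub>R \<beta>)"
    proof (rule Bochner_Integration.integral_abs_bound_integral)
      have "integrable lborel (\<lambda>t. \<Sum>i\<le>m. b i * h i t)"
        by (intro Bochner_Integration.integrable_sum integrable_mult_right hint) auto
      then show "integrable lborel (\<lambda>t. ?I t * G t * ?K t)"
        by (simp add: h_def G_def sum_distrib_left sum_distrib_right algebra_simps)
      show "integrable lborel (\<lambda>t. \<alpha> * (?I t *\<^sub>R ?K t) + ?I t *\<^sub>R \<beta>)"
        by (intro Bochner_Integration.integrable_add integrable_mult_right iK)
      show "\<bar>?I t * G t * ?K t\<bar> \<le> \<alpha> * (?I t *\<^sub>R ?K t) + ?I t *\<^sub>R \<beta>" for t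
        using GK[of t] by (auto simp: indicator_def)
    qed
    also have "\<dots> = \<alpha> * w + measure lborel (cball (0::real^'n) 2) * \<beta>"
      unfolding w_def set_lebesgue_integral_def integral_mult_right_zero
        Bochner_Integration.integral_add[OF integrable_mult_right[OF iK(1)] iK(2)]
      by simp
    finally have "w * \<bar>u x - P x\<bar> \<le> \<alpha> * w + measure lborel (cball (0::real^'n) 2) * \<beta>"
      unfolding main[symmetric] using w b0 by (simp add: abs_mult)
    then have "\<bar>u x - P x\<bar> \<le> (\<alpha> * w + measure lborel (cball (0::real^'n) 2) * \<beta>) / w"
      using w by (simp add: field_simps)
    also have "\<dots> = ((2 * real CARD('n) * \<delta>) ^ m
        + (\<Sum>i\<le>m. \<bar>b i\<bar>) * (2 / \<delta>) ^ (2 * r) * measure lborel (cball (0::real^'n) 2) / w) * ?U"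
      using w by (simp add: \<alpha>_def \<beta>_def add_divide_distrib algebra_simps)
    finally show ?thesis .
  qed
  ultimately show ?thesis by blast
qed

text \<open>With \<open>\<delta>\<close> of order \<open>a\<^bsup>-(m-1)\<^esup>\<close> and kernel degree of order \<open>a\<^sup>m\<close>, the truncation radius exceeds
  the width of the kernel by the factor \<open>a\<close>, so a fixed power \<open>r\<close> makes the tail negligible.
  This costs one order of approximation, which \<open>m = k + 2\<close> can afford.\<close>
lemma poly_space_approximation_rate:
  assumes "1 \<le> m"
  shows "\<exists>C\<ge>0. \<forall>u :: real^'n \<Rightarrow> real. Ck_cball m u \<longrightarrow> (\<forall>a\<ge>1. \<exists>P\<in>poly_space (4 * (m * (CARD('n) + m)) * a ^ m).
     \<forall>x\<in>cball 0 1. \<bar>u x - P x\<bar> \<le> C / (real a ^ m) ^ (m - 1) * Ck_norm m u)"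
proof -
  define d where "d = CARD('n)"
  \<comment> \<open>Chosen so that \<open>m * d + m * (m - 1) \<le> 2 * r\<close>, as the tail
    estimate requires.\<close>
  define r where "r = m * (d + m)"
  define \<omega> where "\<omega> = measure lborel (cball (0::real^'n) 1)"
  define V where "V = measure lborel (cball (0::real^'n) 2)"
  have \<omega>: "\<omega> > 0" unfolding \<omega>_def by (intro content_cball_pos) simp
  obtain b where b: "b 0 = (-1) ^ m"
    "\<And>(v::real^'n) f x. fdiff m v f x = (\<Sum>i\<le>m. b i * f (x + real i *\<^sub>R v))"
    using fdiff_expand[of m] by blast
  define B where "B = (\<Sum>i\<le>m. \<bar>b i\<bar>)"
  have B: "B \<ge> 0" unfolding B_def by (simp add: sum_nonneg)
  \<comment> \<open>The first summand comes from the differences, the second from the tail, with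
    \<open>3 ^ d\<close> due to \<open>2 * M + 1 \<le> 3 * M\<close>.\<close>
  define C where "C = (real d / real m) ^ m + B * (4 * real m) ^ (2 * r) * V * 3 ^ d / \<omega>"
  have C: "C \<ge> 0"
    unfolding C_def using B \<omega> by (intro add_nonneg_nonneg divide_nonneg_nonneg mult_nonneg_nonneg) (auto simp: V_def)
  show ?thesis
  proof (intro exI[of _ C] conjI C allI impI)
    fix u :: "real^'n \<Rightarrow> real" and a :: nat
    assume u: "Ck_cball m u" and a: "1 \<le> a"
    define M where "M = a ^ m"
    \<comment> \<open>This gives \<open>real m * \<delta> < 1\<close>, and
      \<open>\<delta> ^ m\<close> has exactly the target order a^-(m(m-1)).\<close>
    define \<delta> where "\<delta> = 1 / (2 * real m * real a ^ (m - 1))"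
    define w where "w = (LINT t:cball (0::real^'n) 2|lborel. ball_kernel M r t)"
    have a0: "real a \<ge> 1" using a by simp
    have m0: "real m > 0" using assms by simp
    have \<delta>: "0 < \<delta>" unfolding \<delta>_def using a0 m0 by simp
    have "real m * \<delta> = 1 / (2 * real a ^ (m - 1))" using m0 by (simp add: \<delta>_def)
    also have "\<dots> < 1"
      using one_le_power[OF a0, of "m - 1"] by (intro divide_less_eq_1_pos[THEN iffD2]) linarith+
    finally have m\<delta>: "real m * \<delta> < 1" .
    obtain P where P: "P \<in> poly_space (4 * r * M)" "\<And>x. x \<in> ball 0 1 \<Longrightarrow> \<bar>u x - P x\<bar>
      \<le> ((2 * real d * \<delta>) ^ m + B * (2 / \<delta>) ^ (2 * r) * V / w) * Ck_norm m u"
      using poly_space_approximation[OF u \<delta> m\<delta> assms b, of r M] unfolding d_def B_def V_def w_def by blast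
    have M1: "real M \<ge> 1" unfolding M_def using a0 by (simp add: one_le_power)
    have U0: "Ck_norm m u \<ge> 0" using abs_le_Ck_norm[OF u, of 0] by simp
    have first: "(2 * real d * \<delta>) ^ m = (real d / real m) ^ m / (real a ^ m) ^ (m - 1)"
      unfolding \<delta>_def using m0 a0
      by (simp add: power_divide power_mult_distrib power_mult[symmetric] mult.commute field_simps)
    have wge: "real M ^ (2 * r) * \<omega> / (3 ^ d * real M ^ d) \<le> w"
    proof -
      have "real M ^ (2 * r) \<le> ((2 * real M + 1) / 2) ^ (2 * r)"
        by (intro power_mono) auto
      moreover have "(2 * real M + 1) ^ d \<le> (3 * real M) ^ d"
        using M1 by (intro power_mono) auto
      ultimately have "real M ^ (2 * r) * \<omega> / (3 * real M) ^ d
          \<le> ((2 * real M + 1) / 2) ^ (2 * r) * \<omega> / (2 * real M + 1) ^ d"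
        using \<omega> by (intro frac_le mult_right_mono) auto
      also have "\<dots> \<le> w"
        unfolding \<omega>_def w_def d_def by (rule ball_kernel_mean_ge)
      finally show ?thesis by (simp add: power_mult_distrib)
    qed
    have den: "real M ^ (2 * r) * \<omega> / (3 ^ d * real M ^ d) > 0"
      using M1 \<omega> by (intro divide_pos_pos mult_pos_pos zero_less_power) auto
    \<comment> \<open>Up to constants the tail is a^((m-1) 2r) and \<open>w\<close> is at least a^(m
      2r - m d); the surplus a^(2r) must cover both a^(m d) and the rate a^(m(m-1)).\<close>
    have expo: "real a ^ ((m - 1) * (2 * r)) * real a ^ (m * d) * (real a ^ m) ^ (m - 1) \<le> real M ^ (2 * r)"
    proof -
      have "m * (m - 1) \<le> m * m" by simp
      then have "m * d + m * (m - 1) \<le> 2 * r" by (simp add: r_def algebra_simps)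
      moreover have "m * (2 * r) = (m - 1) * (2 * r) + 2 * r"
        using assms by (cases m) auto
      ultimately have "(m - 1) * (2 * r) + m * d + m * (m - 1) \<le> m * (2 * r)" by linarith
      then have "real a ^ ((m - 1) * (2 * r) + m * d + m * (m - 1)) \<le> real a ^ (m * (2 * r))"
        using a0 by (intro power_increasing) auto
      then show ?thesis by (simp add: M_def power_add power_mult)
    qed
    have "B * (2 / \<delta>) ^ (2 * r) * V / w
        \<le> B * (2 / \<delta>) ^ (2 * r) * V / (real M ^ (2 * r) * \<omega> / (3 ^ d * real M ^ d))"
      using \<delta> less_le_trans[OF den wge]
      by (intro divide_left_mono mult_nonneg_nonneg mult_pos_pos wge den B) (auto simp: V_def)
    also have "\<dots> = (B * (4 * real m) ^ (2 * r) * V * 3 ^ d / \<omega>)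
        * (real a ^ ((m - 1) * (2 * r)) * real a ^ (m * d) / real M ^ (2 * r))"
    proof -
      have "(2 / \<delta>) ^ (2 * r) = (4 * real m) ^ (2 * r) * real a ^ ((m - 1) * (2 * r))"
        unfolding power_mult[of _ "m - 1"] power_mult_distrib[symmetric]
        by (rule arg_cong[of _ _ "\<lambda>y. y ^ (2 * r)"]) (simp add: \<delta>_def)
      moreover have "real M ^ d = real a ^ (m * d)"
        by (simp add: M_def power_mult)
      ultimately show ?thesis by (simp only:) (simp only: times_divide_eq_left times_divide_eq_right divide_divide_eq_right divide_divide_eq_left mult_ac)
    qed
    also have "\<dots> \<le> (B * (4 * real m) ^ (2 * r) * V * 3 ^ d / \<omega>) * (1 / (real a ^ m) ^ (m - 1))"
      using expo B \<omega> M1 a0 by (intro mult_left_mono) (auto simp: V_def field_simps)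
    finally have second: "B * (2 / \<delta>) ^ (2 * r) * V / w
        \<le> (B * (4 * real m) ^ (2 * r) * V * 3 ^ d / \<omega>) / (real a ^ m) ^ (m - 1)" by simp
    have "(2 * real d * \<delta>) ^ m + B * (2 / \<delta>) ^ (2 * r) * V / w \<le> C / (real a ^ m) ^ (m - 1)"
      using first second unfolding C_def add_divide_distrib by linarith
    then have bound: "\<bar>u x - P x\<bar> \<le> C / (real a ^ m) ^ (m - 1) * Ck_norm m u" if "x \<in> ball 0 1" for x
      using P(2)[OF that] mult_right_mono[OF _ U0] by (meson order_trans)
    have "continuous_on (closure (ball 0 1)) (\<lambda>x. u x - P x)"
      using u continuous_poly_space[OF P(1)] by (simp add: Ck_cball_def continuous_on_diff)
    from continuous_on_closure_norm_le[OF this, of "C / (real a ^ m) ^ (m - 1) * Ck_norm m u"] bound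
    have "\<forall>x\<in>cball 0 1. \<bar>u x - P x\<bar> \<le> C / (real a ^ m) ^ (m - 1) * Ck_norm m u"
      by simp
    then show "\<exists>P\<in>poly_space (4 * (m * (CARD('n) + m)) * a ^ m).
        \<forall>x\<in>cball 0 1. \<bar>u x - P x\<bar> \<le> C / (real a ^ m) ^ (m - 1) * Ck_norm m u"
      using P(1) unfolding r_def d_def M_def by blast
  qed
qed

text \<open>The correction on the sphere doubles the error, since \<open>P\<close> is as small there
  as its distance to \<open>u\<close>. A general \<open>n\<close> is served by the largest
  admissible degree \<open>s * a ^ m\<close>; as \<open>n < s * (a + 1) ^ m\<close>, rounding down
  costs only a constant factor.\<close>

lemma vanishing_poly_space_approximation:
  assumes "2 \<le> m"
  shows "\<exists>D\<ge>0. \<forall>u :: real^'n \<Rightarrow> real. Ck_cball m u \<and> (\<forall>x\<in>sphere 0 1. u x = 0) \<longrightarrow>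
    (\<forall>n\<ge>1. \<exists>q\<in>vanishing_poly_space n. \<forall>x\<in>cball 0 1. \<bar>u x - q x\<bar> \<le> D / real n ^ (m - 1) * Ck_norm m u)"
proof -
  define s where "s = 4 * (m * (CARD('n) + m))"
  have s: "s > 0" using assms by (simp add: s_def)
  obtain C where C: "C \<ge> 0" "\<And>(u :: real^'n \<Rightarrow> real) a. Ck_cball m u \<Longrightarrow> a \<ge> 1 \<Longrightarrow>
    \<exists>P\<in>poly_space (s * a ^ m). \<forall>x\<in>cball 0 1. \<bar>u x - P x\<bar> \<le> C / (real a ^ m) ^ (m - 1) * Ck_norm m u"
    using poly_space_approximation_rate[of m, where 'n = 'n] assms unfolding s_def by auto
  \<comment> \<open>\<open>2 * C\<close> is the doubled error, the added 1 serves degrees below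
    \<open>s\<close>, and the last factor comes from
    \<open>n \<le> s * 2 ^ m * a ^ m\<close>.\<close>
  define D where "D = (2 * C + 1) * (real s * 2 ^ m) ^ (m - 1)"
  show ?thesis
  proof (intro exI[of _ D] conjI allI impI)
    show "D \<ge> 0" using C(1) by (simp add: D_def)
    fix u :: "real^'n \<Rightarrow> real" and n :: nat
    assume u: "Ck_cball m u \<and> (\<forall>x\<in>sphere 0 1. u x = 0)" and n: "1 \<le> n"
    have U0: "Ck_norm m u \<ge> 0" using abs_le_Ck_norm[of m u 0] u by simp
    show "\<exists>q\<in>vanishing_poly_space n. \<forall>x\<in>cball 0 1. \<bar>u x - q x\<bar> \<le> D / real n ^ (m - 1) * Ck_norm m u"
    proof (cases "s \<le> n")
      case False
      \<comment> \<open>For n below \<open>s\<close> the zero polynomial suffices: its error is at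
        most \<open>Ck_norm m u\<close>, and \<open>n\<close> is bounded by a constant.\<close>
      have "real n ^ (m - 1) \<le> (real s * 2 ^ m) ^ (m - 1)"
      proof (intro power_mono)
        have "real n * 1 \<le> real s * 2 ^ m" using False by (intro mult_mono) auto
        then show "real n \<le> real s * 2 ^ m" by simp
      qed simp
      also have "\<dots> \<le> D"
        unfolding D_def using C(1) mult_right_mono[of 1 "2 * C + 1" "(real s * 2 ^ m) ^ (m - 1)"] by simp
      finally have "1 \<le> D / real n ^ (m - 1)" using n by simp
      then have "\<bar>u x - 0\<bar> \<le> D / real n ^ (m - 1) * Ck_norm m u" if "x \<in> cball 0 1" for x
        using abs_le_Ck_norm[of m u x] u that mult_right_mono[OF _ U0, of 1 "D / real n ^ (m - 1)"] by auto
      then show ?thesis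
        by (intro bexI[OF _ zero_in_vanishing_poly_space]) auto
    next
      case True
      define Q where "Q a \<longleftrightarrow> s * a ^ m \<le> n" for a
      have bnd: "a \<le> n" if "Q a" for a
      proof -
        have "a \<le> a ^ m" using assms self_le_power[of a m] by (cases "a = 0") auto
        also have "\<dots> \<le> s * a ^ m" using s by simp
        finally show ?thesis using that by (simp add: Q_def)
      qed
      define a where "a = (GREATEST a. Q a)"
      have Q1: "Q 1" using True by (simp add: Q_def)
      have Qa: "Q a" unfolding a_def using Q1 bnd by (rule GreatestI_nat)
      have a1: "1 \<le> a" unfolding a_def using Q1 bnd by (rule Greatest_le_nat)
      have "\<not> Q (Suc a)"
        using Greatest_le_nat[of Q "Suc a" n] bnd unfolding a_def[symmetric] by auto
      then have "n < s * Suc a ^ m" by (simp add: Q_def)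
      also have "s * Suc a ^ m \<le> s * (2 * a) ^ m"
        using a1 by (intro mult_le_mono2 power_mono) auto
      finally have "n \<le> s * 2 ^ m * a ^ m" by (simp add: power_mult_distrib)
      then have "real n \<le> real (s * 2 ^ m * a ^ m)" by (simp only: of_nat_le_iff)
      then have "real n ^ (m - 1) \<le> ((real s * 2 ^ m) * real a ^ m) ^ (m - 1)"
        by (intro power_mono) auto
      then have na: "real n ^ (m - 1) \<le> (real s * 2 ^ m) ^ (m - 1) * (real a ^ m) ^ (m - 1)"
        by (simp only: power_mult_distrib)
      define e where "e = C / (real a ^ m) ^ (m - 1) * Ck_norm m u"
      obtain P where P: "P \<in> poly_space (s * a ^ m)" "\<And>x. x \<in> cball 0 1 \<Longrightarrow> \<bar>u x - P x\<bar> \<le> e"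
        using C(2)[of u a] u a1 unfolding e_def by blast
      \<comment> \<open>\<open>s\<close> is a multiple of 4, so the degree is even, as the
        correction on the sphere demands.\<close>
      define L where "L = 2 * (m * (CARD('n) + m)) * a ^ m"
      have L: "s * a ^ m = 2 * L" by (simp add: s_def L_def)
      have "\<bar>P x\<bar> \<le> e" if "x \<in> sphere 0 1" for x
        using P(2)[of x] u that by simp
      then obtain q where q: "q \<in> vanishing_poly_space (2 * L)" "\<And>x. x \<in> cball 0 1 \<Longrightarrow> \<bar>P x - q x\<bar> \<le> e"
        using homogeneous_correction[of P L e] P(1) L by auto
      have "C / (real a ^ m) ^ (m - 1) * 2 \<le> D / real n ^ (m - 1)"
      proof -
        have "C * 2 * real n ^ (m - 1) \<le> (2 * C + 1) * ((real s * 2 ^ m) ^ (m - 1) * (real a ^ m) ^ (m - 1))"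
          using C(1) na by (intro mult_mono) auto
        then show ?thesis
          using n a1 unfolding D_def by (simp add: field_simps)
      qed
      from mult_right_mono[OF this U0] have e2: "2 * e \<le> D / real n ^ (m - 1) * Ck_norm m u"
        by (simp add: e_def mult_ac)
      have "\<bar>u x - q x\<bar> \<le> D / real n ^ (m - 1) * Ck_norm m u" if "x \<in> cball 0 1" for x
        using P(2)[OF that] q(2)[OF that] e2 by linarith
      moreover have "q \<in> vanishing_poly_space n"
        using vanishing_poly_space_mono[OF q(1)] Qa L by (simp add: Q_def)
      ultimately show ?thesis by blast
    qed
  qed
qed

theorem theorem2:
  fixes k :: nat
  assumes "CARD('n::finite) \<ge> 2" and "k \<ge> 1"
  shows "\<exists>D::real. \<forall>u :: real^'n \<Rightarrow> real.
           Ck_cball (k + 2) u \<and> (\<forall>x\<in>sphere 0 1. u x = 0) \<longrightarrow>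
           (\<forall>n::nat\<ge>1. \<exists>q\<in>vanishing_poly_space n.
              sup_norm (\<lambda>x. u x - q x)
                \<le> D * (1 / real n ^ k) *
                   (1 / real n * Ck_norm (k + 2) u + Ck_modulus (k + 2) u (1 / real n)))"
proof -
  obtain D where D: "D \<ge> 0" "\<And>(u :: real^'n \<Rightarrow> real) n. Ck_cball (k + 2) u \<Longrightarrow> (\<forall>x\<in>sphere 0 1. u x = 0) \<Longrightarrow>
    n \<ge> 1 \<Longrightarrow> \<exists>q\<in>vanishing_poly_space n. \<forall>x\<in>cball 0 1. \<bar>u x - q x\<bar> \<le> D / real n ^ (k + 1) * Ck_norm (k + 2) u"
    using vanishing_poly_space_approximation[of "k + 2", where 'n = 'n] by auto
  show ?thesis
  proof (intro exI[of _ D] allI impI)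
    fix u :: "real^'n \<Rightarrow> real" and n :: nat
    assume u: "Ck_cball (k + 2) u \<and> (\<forall>x\<in>sphere 0 1. u x = 0)" and n: "1 \<le> n"
    obtain q where q: "q \<in> vanishing_poly_space n"
      "\<And>x. x \<in> cball 0 1 \<Longrightarrow> \<bar>u x - q x\<bar> \<le> D / real n ^ (k + 1) * Ck_norm (k + 2) u"
      using D(2)[of u n] u n by blast
    have "sup_norm (\<lambda>x. u x - q x) \<le> D / real n ^ (k + 1) * Ck_norm (k + 2) u"
      unfolding sup_norm_def by (intro cSUP_least q(2)) auto
    also have "\<dots> = D * (1 / real n ^ k) * (1 / real n * Ck_norm (k + 2) u)"
      by simp
    \<comment> \<open>With m = k + 2 the rate is n^-(k+1) = n^-k n^-1, and the modulus added here is
      nonnegative.\<close>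
    also have "\<dots> \<le> D * (1 / real n ^ k) *
        (1 / real n * Ck_norm (k + 2) u + Ck_modulus (k + 2) u (1 / real n))"
      using D(1) Ck_modulus_nonneg[of "k + 2" u "1 / real n"] u by (intro mult_left_mono) auto
    finally show "\<exists>q\<in>vanishing_poly_space n. sup_norm (\<lambda>x. u x - q x)
        \<le> D * (1 / real n ^ k) * (1 / real n * Ck_norm (k + 2) u + Ck_modulus (k + 2) u (1 / real n))"
      using q(1) by blast
  qed
qed

end
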